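(* Let $c:\Omega\to\mathbb S_{n_y}$ be a random cost with nonatomic distribution, and let $\beta:X\to\mathscr P(Y)$ be the vertex-supported belief over the fiber map $S$ induced by $c$, i.e. $\beta_x(O)=\sum_{y\in \mathrm{ext}(S(x))}p_c(x,y)\mathbf 1_O(y)$ for $x\in X$ and Borel $O\subseteq Y$, with $p_c(x,y)=\mathbb P[-c(\omega)\in N_{S(x)}(y)]$. Let $d_1\in\mathbb R^{n_x}$ and $d_2\in\mathbb R^{n_y}$. Then: 1. $\beta$ is weak continuous, and thus for any lower semicontinuous function $f:X\times Y\to\mathbb R$ the problem $\min_{x\in X}\mathbb E_{\beta_x}[f(x,\cdot)]$ has a solution. 2. The function $\theta:X\to\mathbb R$ given by $\theta(x):=\langle d_1,x\rangle+\mathbb E_{\beta_x}[\langle d_2,\cdot\rangle]$ is continuous and piecewise linear over the chamber complex $\mathscr C(D)$. In particular, the stochastic bilevel problem $$\min_{x\in\mathbb R^{n_x}}\ \langle d_1,x\rangle+\mathbb E[\langle d_2,y(x,\omega)\rangle]\quad\text{s.t. } A_lx\le b_l,\ \ y(x,\omega)\text{ solves }\min_{y\in\mathbb R^{n_y}}\{\langle c(\omega),y\rangle: A_fx+B_fy\le b_f\}\ \text{ a.s. }\omega\in\Omega,$$ equivalently the problem $\min_{x\in X}\theta(x)$, has at least one solution in $\mathscr V(D)$.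
   Context: Data: $A_l\in\mathbb R^{m_l\times n_x}$, $A_f\in\mathbb R^{m_f\times n_x}$, $B_f\in\mathbb R^{m_f\times n_y}$, $b_l\in\mathbb R^{m_l}$, $b_f\in\mathbb R^{m_f}$; $A=\begin{bmatrix} A_l \\ A_f \end{bmatrix}$, $B=\begin{bmatrix} 0 \\ B_f \end{bmatrix}$, $b=\begin{bmatrix} b_l \\ b_f \end{bmatrix}$. Put $D=\{(x,y)\in\mathbb R^{n_x}\times\mathbb R^{n_y}: Ax+By\le b\}$, assumed to be compact (a polytope) and full-dimensional. Let $\pi(x,y)=x$, $X=\pi(D)$, $Y=\{y: \exists x,\ (x,y)\in D\}$, and let the fiber map be $S(x)=\{y\in\mathbb R^{n_y}:(x,y)\in D\}$ for $x\in X$. $(\Omega,\Sigma,\mathbb P)$ is a probability space and $\mathbb S_{n_y}$ is the unit sphere of $\mathbb R^{n_y}$. A random vector $c:\Omega\to\mathbb S_{n_y}$ has nonatomic distribution if for every Borel $O\subseteq\mathbb S_{n_y}$, $\mathcal H^{n_y-1}(O)=0$ implies $\mathbb P[c(\omega)\in O]=0$, where $\mathcal H^{n_y-1}$ is the $(n_y-1)$-dimensional Hausdorff measure. For a convex set $C$ and $y\in C$, $N_C(y)=\{d:\langle d,z-y\rangle\le0\ \forall z\in C\}$. $\mathrm{ext}(P)$ is the set of vertices of a polytope $P$. $\mathscr P(Y)$ is the set of Borel probability measures on $Y$. A map $\beta:X\to\mathscr P(Y)$ is a belief over $S$ if $\beta_x(S(x))=1$ for all $x\in X$; it is weak continuous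 if for every sequence $x_k\to x$ in $X$, $\int_Y h\,d\beta_{x_k}\to\int_Y h\,d\beta_x$ for all continuous $h:Y\to\mathbb R$. $\mathbb E_{\beta_x}[h]=\int_Y h\,d\beta_x$. A face of a polytope $P$ is the set of maximizers over $P$ of a linear function ($P$ itself is a face); $\mathscr F(D)$ is the set of all faces of $D$. For $x\in X$ the chamber of $x$ is $\sigma(x)=\bigcap\{\pi(F):F\in\mathscr F(D),\ x\in\pi(F)\}$, the chamber complex is $\mathscr C(D)=\{\sigma(x):x\in X\}$ (a finite polyhedral complex), and $\mathscr V(D)=\{v\in X:\{v\}\in\mathscr C(D)\}$ is the set of chamber vertices. A function $f:X\to\mathbb R$ is piecewise linear over $\mathscr C(D)$ if there are pairs $(d_C,a_C)\in\mathbb R^{n_x}\times\mathbb R$, $C\in\mathscr C(D)$, such that $f(x)=\sum_{C\in\mathscr C(D)}(\langle d_C,x\rangle+a_C)\mathbf 1_{\mathrm{ri}(C)}(x)$ for all $x\in X$ (ri = relative interior). The bilevel problem is understood through its Bayesian reformulation $\min_{x\in X}\theta(x)$. *)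

theory Defs
  imports "HOL-Probability.Probability"
begin

section \<open>Hausdorff measure and nonatomic random costs\<close>

text \<open>
  The unnormalised Hausdorff (outer) measure of integer dimension: the usual dimensional
  constant is omitted, which does not affect null sets. Covers are restricted to bounded
  sets because \<^const>\<open>diameter\<close> is unspecified on unbounded ones. Empty sets contribute
  0 also for \<open>d = 0\<close>, so that the 0-dimensional measure is the counting measure.
\<close>

definition hausdorff_premeasure :: "nat \<Rightarrow> real \<Rightarrow> 'a::metric_space set \<Rightarrow> ennreal" where
  "hausdorff_premeasure d \<delta> A =
     (INF U \<in> {U :: nat \<Rightarrow> 'a set. A \<subseteq> (\<Union>i. U i) \<and> (\<forall>i. bounded (U i) \<and> diameter (U i) \<le> \<delta>)}.
        \<Sum>i. if U i = {} then 0 else ennreal (diameter (U i) ^ d))"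

definition hausdorff_measure :: "nat \<Rightarrow> 'a::metric_space set \<Rightarrow> ennreal" where
  "hausdorff_measure d A = (SUP \<delta> \<in> {0<..}. hausdorff_premeasure d \<delta> A)"

definition nonatomic_cost :: "'w measure \<Rightarrow> ('w \<Rightarrow> 'a::euclidean_space) \<Rightarrow> bool" where
  "nonatomic_cost M c \<longleftrightarrow>
     c \<in> borel_measurable M \<and> (\<forall>\<omega> \<in> space M. c \<omega> \<in> sphere 0 1) \<and>
     (\<forall>O1 \<in> sets borel. O1 \<subseteq> sphere 0 1 \<longrightarrow> hausdorff_measure (DIM('a) - 1) O1 = 0 \<longrightarrow>
        measure M {\<omega> \<in> space M. c \<omega> \<in> O1} = 0)"

section \<open>The constraint set, its fibers and its chamber complex\<close>

text \<open>
  The block system \<open>A x + B y \<le> b\<close>, written blockwise; \<open>\<le>\<close> on vectors is componentwise.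
\<close>

definition constraint_set ::
  "real^'n^'l \<Rightarrow> real^'n^'f \<Rightarrow> real^'p^'f \<Rightarrow> real^'l \<Rightarrow> real^'f \<Rightarrow> ((real^'n) \<times> (real^'p)) set" where
  "constraint_set Al Af Bf bl bf = {(x, y). Al *v x \<le> bl \<and> Af *v x + Bf *v y \<le> bf}"

definition fiber :: "('a \<times> 'b) set \<Rightarrow> 'a \<Rightarrow> 'b set" where
  "fiber D x = {y. (x, y) \<in> D}"

text \<open>
  Unlike \<^const>\<open>face_of\<close>, this never yields the empty face of a nonempty polytope.
\<close>

definition faces :: "'a::real_inner set \<Rightarrow> 'a set set" where
  "faces P = {F. \<exists>d. F = {z \<in> P. \<forall>w \<in> P. inner d w \<le> inner d z}}"

definition chamber :: "('a::real_inner \<times> 'b::real_inner) set \<Rightarrow> 'a \<Rightarrow> 'a set" where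
  "chamber D x = \<Inter> {fst ` F | F. F \<in> faces D \<and> x \<in> fst ` F}"

definition chamber_complex :: "('a::real_inner \<times> 'b::real_inner) set \<Rightarrow> 'a set set" where
  "chamber_complex D = chamber D ` (fst ` D)"

definition chamber_vertices :: "('a::real_inner \<times> 'b::real_inner) set \<Rightarrow> 'a set" where
  "chamber_vertices D = {v \<in> fst ` D. {v} \<in> chamber_complex D}"

text \<open>
  Finiteness is demanded explicitly since a sum over an infinite set is 0 by convention.
\<close>

definition piecewise_linear_over ::
  "'a::euclidean_space set set \<Rightarrow> 'a set \<Rightarrow> ('a \<Rightarrow> real) \<Rightarrow> bool" where
  "piecewise_linear_over \<C> X f \<longleftrightarrow> finite \<C> \<and>
     (\<exists>(d :: 'a set \<Rightarrow> 'a) (a :: 'a set \<Rightarrow> real). \<forall>x \<in> X.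
        f x = (\<Sum>C\<in>\<C>. (inner (d C) x + a C) * indicator (rel_interior C) x))"

section \<open>Beliefs\<close>

definition normal_cone :: "'a::real_inner set \<Rightarrow> 'a \<Rightarrow> 'a set" where
  "normal_cone C y = {d. \<forall>z \<in> C. inner d (z - y) \<le> 0}"

definition optimality_prob ::
  "'w measure \<Rightarrow> ('w \<Rightarrow> 'b::real_inner) \<Rightarrow> ('a \<Rightarrow> 'b set) \<Rightarrow> 'a \<Rightarrow> 'b \<Rightarrow> real" where
  "optimality_prob M c S x y = measure M {\<omega> \<in> space M. - c \<omega> \<in> normal_cone (S x) y}"

definition vertex_belief ::
  "'w measure \<Rightarrow> ('w \<Rightarrow> 'b::euclidean_space) \<Rightarrow> 'b set \<Rightarrow> ('a \<Rightarrow> 'b set) \<Rightarrow> 'a \<Rightarrow> 'b measure" where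
  "vertex_belief M c Y S x =
     measure_of Y (sets (restrict_space borel Y))
       (\<lambda>O1. ennreal (\<Sum>y | y extreme_point_of S x. optimality_prob M c S x y * indicator O1 y))"

text \<open>
  \<^const>\<open>measure_of\<close> yields the null measure when its argument is not a measure;
  the following shows that this does not happen here.
\<close>

lemma sets_vertex_belief: "sets (vertex_belief M c Y S x) = sets (restrict_space borel Y)"
proof -
  have "sigma_sets Y (sets (restrict_space borel Y)) = sets (restrict_space borel Y)"
    using sets.sigma_sets_eq[of "restrict_space borel Y"] by (simp add: space_restrict_space)
  moreover have "sets (restrict_space borel Y) \<subseteq> Pow Y"
    using sets.space_closed[of "restrict_space borel Y"] by (simp add: space_restrict_space)
  ultimately show ?thesis
    by (simp add: vertex_belief_def)
qed

lemma emeasure_vertex_belief: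
  assumes "O1 \<in> sets (restrict_space borel Y)"
  shows "emeasure (vertex_belief M c Y S x) O1 =
    ennreal (\<Sum>y | y extreme_point_of S x. optimality_prob M c S x y * indicator O1 y)"
proof -
  let ?N = "restrict_space borel Y"
  let ?E = "{y. y extreme_point_of S x}"
  let ?\<mu> = "\<lambda>O1. ennreal (\<Sum>y\<in>?E. optimality_prob M c S x y * indicator O1 y)"
  have eq: "?\<mu> A = (\<Sum>y\<in>?E. ennreal (optimality_prob M c S x y) * indicator A y)" for A
    by (subst sum_ennreal[symmetric])
       (auto simp: optimality_prob_def ennreal_mult indicator_def intro!: sum.cong)
  have ca: "countably_additive (sets ?N) ?\<mu>"
    unfolding countably_additive_def
  proof (intro allI impI)
    fix A :: "nat \<Rightarrow> 'a set"
    assume "range A \<subseteq> sets ?N" and disj: "disjoint_family A"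
    have "(\<Sum>i. ?\<mu> (A i)) =
        (\<Sum>y\<in>?E. \<Sum>i. ennreal (optimality_prob M c S x y) * indicator (A i) y)"
      unfolding eq by (rule suminf_sum) auto
    also have "\<dots> = ?\<mu> (\<Union>i. A i)"
      unfolding eq ennreal_suminf_cmult suminf_indicator[OF disj] ..
    finally show "(\<Sum>i. ?\<mu> (A i)) = ?\<mu> (\<Union>i. A i)" .
  qed
  have pos: "positive (sets ?N) ?\<mu>"
    by (simp add: positive_def)
  have "sigma_algebra Y (sets ?N)"
    using sets.sigma_algebra_axioms[of ?N] by (simp add: space_restrict_space)
  from emeasure_measure_of_sigma[OF this pos ca assms] show ?thesis
    by (simp add: vertex_belief_def)
qed

definition belief_over :: "'a set \<Rightarrow> 'b::euclidean_space set \<Rightarrow> ('a \<Rightarrow> 'b set) \<Rightarrow> ('a \<Rightarrow> 'b measure) \<Rightarrow> bool" where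
  "belief_over X Y S \<beta> \<longleftrightarrow>
     (\<forall>x \<in> X. \<beta> x \<in> space (prob_algebra (restrict_space borel Y)) \<and> emeasure (\<beta> x) (S x) = 1)"

definition weak_continuous ::
  "'a::topological_space set \<Rightarrow> 'b::euclidean_space set \<Rightarrow> ('a \<Rightarrow> 'b measure) \<Rightarrow> bool" where
  "weak_continuous X Y \<beta> \<longleftrightarrow>
     (\<forall>(u :: nat \<Rightarrow> 'a) x. (\<forall>k. u k \<in> X) \<longrightarrow> x \<in> X \<longrightarrow> u \<longlonglongrightarrow> x \<longrightarrow>
        (\<forall>h :: 'b \<Rightarrow> real. continuous_on Y h \<longrightarrow>
           (\<lambda>k. \<integral>y. h y \<partial>(\<beta> (u k))) \<longlonglongrightarrow> (\<integral>y. h y \<partial>(\<beta> x))))"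

definition lower_semicontinuous_on :: "'a::topological_space set \<Rightarrow> ('a \<Rightarrow> real) \<Rightarrow> bool" where
  "lower_semicontinuous_on S f \<longleftrightarrow>
     (\<forall>z \<in> S. \<forall>a < f z. eventually (\<lambda>w. a < f w) (at z within S))"

section \<open>The stochastic bilevel problem\<close>

text \<open>
  A decision is a leader variable \<open>x\<close> with a random follower response \<open>y = y(x, \<cdot>)\<close>,
  required to be measurable so that the expectation in the objective makes sense.
\<close>

definition bilevel_feasible ::
  "'w measure \<Rightarrow> ('w \<Rightarrow> real^'p) \<Rightarrow> real^'n^'l \<Rightarrow> real^'n^'f \<Rightarrow> real^'p^'f \<Rightarrow> real^'l \<Rightarrow> real^'f \<Rightarrow>
   (real^'n) \<times> ('w \<Rightarrow> real^'p) \<Rightarrow> bool" where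
  "bilevel_feasible M c Al Af Bf bl bf = (\<lambda>(x, y).
     Al *v x \<le> bl \<and> y \<in> borel_measurable M \<and>
     (AE \<omega> in M. is_arg_min (\<lambda>u. inner (c \<omega>) u) (\<lambda>u. Af *v x + Bf *v u \<le> bf) (y \<omega>)))"

definition bilevel_objective ::
  "'w measure \<Rightarrow> real^'n \<Rightarrow> real^'p \<Rightarrow> (real^'n) \<times> ('w \<Rightarrow> real^'p) \<Rightarrow> real" where
  "bilevel_objective M d1 d2 = (\<lambda>(x, y). inner d1 x + (\<integral>\<omega>. inner d2 (y \<omega>) \<partial>M))"

end

theory Submission
  imports Defs
begin

text \<open>
  The proof replaces the belief by a random variable. For each leader variable \<open>x\<close>, let \<open>y(x, \<omega>)\<close>
  be a measurable choice of a vertex of the fiber \<open>S(x)\<close> that minimises \<open>c(\<omega>)\<close>. Two vertices tie only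
  if \<open>c(\<omega>)\<close> is orthogonal to their difference, that is, if it lies in a great subsphere of codimension
  one. Great subspheres are null for the \<open>(n - 1)\<close>-dimensional Hausdorff measure (they are Lipschitz
  images of the boundary of a cube of dimension \<open>n - 1\<close>, where \<open>n\<close> is the dimension of the
  follower's space), so that almost surely \<open>y(x, \<omega>)\<close> is the only minimiser over \<open>S(x)\<close>. Hence \<open>\<beta>\<^sub>x\<close> is the law of \<open>y(x, \<cdot>)\<close>, lemma \<open>vertex_belief_eq_distr\<close>, and every
  feasible response in the bilevel problem agrees with \<open>y(x, \<cdot>)\<close> almost surely.

  Weak continuity and existence of solutions: a polyhedron is locally a cone, whence every point of
  \<open>S(x)\<close> is a limit of points of \<open>S(x\<^sub>k)\<close> when \<open>x\<^sub>k \<longlonglongrightarrow> x\<close>; so \<open>y(x\<^sub>k, \<omega>) \<longlonglongrightarrow> y(x, \<omega>)\<close> as soon as the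
  minimiser over \<open>S(x)\<close> is unique (\<open>fiber_minimisers_converge\<close>). Dominated convergence gives weak
  continuity, and Fatou's lemma gives lower semicontinuity of the expected cost.

  Piecewise linearity: if a minimiser \<open>(x, v)\<close> lies in the relative interior of a face \<open>F\<close> of \<open>D\<close>, then
  every point of \<open>F\<close> is a minimiser over its own fiber (\<open>fiber_minimiser_propagates\<close>). The chamber of
  \<open>x\<close> is contained in the projection of \<open>F\<close>, so over the whole closed chamber the minimiser is read off
  the convex set \<open>F\<close>; being unique, it is affine there, and so is its expectation. The relative
  interiors of the chambers partition \<open>X\<close> by \<open>mem_rel_interior_chamber\<close> and
  \<open>chamber_eq_if_mem_rel_interior\<close>, the latter again through propagation of minimisers. Finally, a
  minimiser of \<open>\<theta>\<close> can be moved to an extreme point of its chamber, and such an extreme point is a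
  chamber vertex because it cannot lie in the relative interior of a larger chamber.
\<close>

section \<open>Great subspheres are null for the Hausdorff measure\<close>

text \<open>
  A quantitative form of ``upper box dimension at most \<open>e\<close>'': for every \<open>k\<close>, the set is covered
  by \<open>O(k^e)\<close> sets of diameter \<open>O(1/k)\<close>. The diameter bound is expressed through distances, so
  that no boundedness side condition is needed.
\<close>

definition box_content_finite :: "nat \<Rightarrow> 'a::metric_space set \<Rightarrow> bool" where
  "box_content_finite e A \<longleftrightarrow>
     (\<exists>N L. 0 \<le> N \<and> 0 \<le> L \<and>
       (\<forall>k\<ge>1. \<exists>\<U>. finite \<U> \<and> A \<subseteq> \<Union>\<U> \<and> real (card \<U>) \<le> N * real k ^ e \<and>
          (\<forall>U\<in>\<U>. \<forall>x\<in>U. \<forall>y\<in>U. dist x y \<le> L / real k)))"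

lemma hausdorff_premeasure_finite_cover:
  fixes A :: "'a::metric_space set"
  assumes fin: "finite \<U>" and cov: "A \<subseteq> \<Union>\<U>" and "0 \<le> r" "r \<le> \<delta>"
    and small: "\<And>U x y. U \<in> \<U> \<Longrightarrow> x \<in> U \<Longrightarrow> y \<in> U \<Longrightarrow> dist x y \<le> r"
  shows "hausdorff_premeasure d \<delta> A \<le> ennreal (real (card \<U>) * r ^ d)"
proof -
  obtain f where f: "bij_betw f {..<card \<U>} \<U>"
    using fin ex_bij_betw_nat_finite[of \<U>] by (auto simp: atLeast0LessThan)
  define V where "V n = (if n < card \<U> then f n else {})" for n
  have V: "bounded (V n) \<and> diameter (V n) \<le> r" for n
  proof (cases "n < card \<U>")
    case True
    then have "f n \<in> \<U>" using f by (auto simp: bij_betw_def)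
    then have *: "dist x y \<le> r" if "x \<in> f n" "y \<in> f n" for x y
      using small that by blast
    then have "bounded (f n)"
      by (metis bounded_empty bounded_def equals0I)
    moreover have "diameter (f n) \<le> r"
      using * \<open>0 \<le> r\<close> by (auto simp: diameter_def intro!: cSUP_least)
    ultimately show ?thesis
      by (simp add: V_def True)
  qed (simp add: V_def \<open>0 \<le> r\<close>)
  have "A \<subseteq> (\<Union>n. V n)"
  proof
    fix x assume "x \<in> A"
    then obtain U where "U \<in> \<U>" "x \<in> U" using cov by blast
    moreover have "U \<in> f ` {..<card \<U>}"
      using f \<open>U \<in> \<U>\<close> by (simp add: bij_betw_def)
    then obtain n where "n < card \<U>" "f n = U" by auto
    ultimately show "x \<in> (\<Union>n. V n)" by (auto simp: V_def)
  qed
  then have "hausdorff_premeasure d \<delta> A \<le>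
      (\<Sum>i. if V i = {} then 0 else ennreal (diameter (V i) ^ d))"
    unfolding hausdorff_premeasure_def
    using V \<open>r \<le> \<delta>\<close> by (intro INF_lower) (auto intro: order_trans)
  also have "\<dots> = (\<Sum>i<card \<U>. if V i = {} then 0 else ennreal (diameter (V i) ^ d))"
    by (rule suminf_finite) (auto simp: V_def)
  also have "\<dots> \<le> (\<Sum>i<card \<U>. ennreal (r ^ d))"
  proof (rule sum_mono)
    fix i
    have "0 \<le> diameter (V i)" using V diameter_ge_0 by blast
    then show "(if V i = {} then 0 else ennreal (diameter (V i) ^ d)) \<le> ennreal (r ^ d)"
      using V[of i] by (auto intro!: ennreal_leI power_mono)
  qed
  also have "\<dots> = ennreal (real (card \<U>) * r ^ d)"
    by (subst sum_ennreal) (use \<open>0 \<le> r\<close> in auto)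
  finally show ?thesis .
qed

lemma hausdorff_measure_eq_0_if_box_content_finite:
  fixes A :: "'a::metric_space set"
  assumes "box_content_finite e A"
  shows "hausdorff_measure (Suc e) A = 0"
proof -
  obtain N L where NL: "0 \<le> N" "0 \<le> L"
    and cov: "\<And>k. k \<ge> 1 \<Longrightarrow> \<exists>\<U>. finite \<U> \<and> A \<subseteq> \<Union>\<U> \<and> real (card \<U>) \<le> N * real k ^ e \<and>
          (\<forall>U\<in>\<U>. \<forall>x\<in>U. \<forall>y\<in>U. dist x y \<le> L / real k)"
    using assms unfolding box_content_finite_def by blast
  have "hausdorff_premeasure (Suc e) \<delta> A = 0" if "\<delta> > 0" for \<delta>
  proof -
    have bound: "hausdorff_premeasure (Suc e) \<delta> A \<le> ennreal (N * L ^ Suc e / real k)"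
      if k: "k \<ge> 1" "L / real k \<le> \<delta>" for k
    proof -
      obtain \<U> where U: "finite \<U>" "A \<subseteq> \<Union>\<U>" "real (card \<U>) \<le> N * real k ^ e"
        "\<And>U x y. U \<in> \<U> \<Longrightarrow> x \<in> U \<Longrightarrow> y \<in> U \<Longrightarrow> dist x y \<le> L / real k"
        using cov[OF k(1)] by blast
      have "hausdorff_premeasure (Suc e) \<delta> A \<le> ennreal (real (card \<U>) * (L / real k) ^ Suc e)"
        by (rule hausdorff_premeasure_finite_cover) (use U k NL in auto)
      also have "\<dots> \<le> ennreal ((N * real k ^ e) * (L / real k) ^ Suc e)"
        by (intro ennreal_leI mult_right_mono U) (use NL in auto)
      also have "(N * real k ^ e) * (L / real k) ^ Suc e = N * L ^ Suc e / real k"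
        using k(1) by (simp add: field_simps)
      finally show ?thesis .
    qed
    have "(\<lambda>k. ennreal (N * L ^ Suc e / real k)) \<longlonglongrightarrow> ennreal 0"
      by (intro tendsto_ennrealI lim_const_over_n)
    moreover have "\<forall>\<^sub>F k in sequentially. L / real k < \<delta>"
      using lim_const_over_n[of L] \<open>\<delta> > 0\<close> by (rule order_tendstoD)
    then have "\<forall>\<^sub>F k in sequentially.
        hausdorff_premeasure (Suc e) \<delta> A \<le> ennreal (N * L ^ Suc e / real k)"
      using eventually_ge_at_top[of 1] by eventually_elim (rule bound, auto)
    ultimately have "hausdorff_premeasure (Suc e) \<delta> A \<le> ennreal 0"
      by (rule tendsto_lowerbound) simp
    then show ?thesis by simp
  qed
  then show ?thesis
    by (simp add: hausdorff_measure_def)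
qed

lemma box_content_finite_subset:
  assumes "box_content_finite e B" "A \<subseteq> B"
  shows "box_content_finite e A"
proof -
  obtain N L where "0 \<le> N" "0 \<le> L" and
    k: "\<And>k. k \<ge> 1 \<Longrightarrow> \<exists>\<U>. finite \<U> \<and> B \<subseteq> \<Union>\<U> \<and> real (card \<U>) \<le> N * real k ^ e \<and>
          (\<forall>U\<in>\<U>. \<forall>x\<in>U. \<forall>y\<in>U. dist x y \<le> L / real k)"
    using assms(1) unfolding box_content_finite_def by blast
  moreover have "\<exists>\<U>. finite \<U> \<and> A \<subseteq> \<Union>\<U> \<and> real (card \<U>) \<le> N * real k ^ e \<and>
          (\<forall>U\<in>\<U>. \<forall>x\<in>U. \<forall>y\<in>U. dist x y \<le> L / real k)" if "k \<ge> 1" for k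
    using k[OF that] assms(2) by (meson subset_trans)
  ultimately show ?thesis unfolding box_content_finite_def by blast
qed

lemma box_content_finite_empty: "box_content_finite e {}"
  unfolding box_content_finite_def
  by (rule exI[of _ 0], rule exI[of _ 0]) (auto intro!: exI[of _ "{}"])

lemma box_content_finite_Un:
  assumes "box_content_finite e A" "box_content_finite e B"
  shows "box_content_finite e (A \<union> B)"
proof -
  obtain N L where NL: "0 \<le> N" "0 \<le> L" and
    A: "\<And>k. k \<ge> 1 \<Longrightarrow> \<exists>\<U>. finite \<U> \<and> A \<subseteq> \<Union>\<U> \<and> real (card \<U>) \<le> N * real k ^ e \<and>
          (\<forall>U\<in>\<U>. \<forall>x\<in>U. \<forall>y\<in>U. dist x y \<le> L / real k)"
    using assms(1) unfolding box_content_finite_def by blast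
  obtain N' L' where NL': "0 \<le> N'" "0 \<le> L'" and
    B: "\<And>k. k \<ge> 1 \<Longrightarrow> \<exists>\<U>. finite \<U> \<and> B \<subseteq> \<Union>\<U> \<and> real (card \<U>) \<le> N' * real k ^ e \<and>
          (\<forall>U\<in>\<U>. \<forall>x\<in>U. \<forall>y\<in>U. dist x y \<le> L' / real k)"
    using assms(2) unfolding box_content_finite_def by blast
  have "\<exists>\<U>. finite \<U> \<and> A \<union> B \<subseteq> \<Union>\<U> \<and> real (card \<U>) \<le> (N + N') * real k ^ e \<and>
          (\<forall>U\<in>\<U>. \<forall>x\<in>U. \<forall>y\<in>U. dist x y \<le> max L L' / real k)" if k: "k \<ge> 1" for k
  proof -
    obtain \<U> where U: "finite \<U>" "A \<subseteq> \<Union>\<U>" "real (card \<U>) \<le> N * real k ^ e"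
        "\<forall>U\<in>\<U>. \<forall>x\<in>U. \<forall>y\<in>U. dist x y \<le> L / real k"
      using A[OF k] by blast
    obtain \<V> where V: "finite \<V>" "B \<subseteq> \<Union>\<V>" "real (card \<V>) \<le> N' * real k ^ e"
        "\<forall>U\<in>\<V>. \<forall>x\<in>U. \<forall>y\<in>U. dist x y \<le> L' / real k"
      using B[OF k] by blast
    have "real (card (\<U> \<union> \<V>)) \<le> real (card \<U>) + real (card \<V>)"
      using card_Un_le[of \<U> \<V>] by linarith
    also have "\<dots> \<le> (N + N') * real k ^ e"
      using U V by (simp add: algebra_simps)
    finally have card: "real (card (\<U> \<union> \<V>)) \<le> (N + N') * real k ^ e" .
    have le: "L / real k \<le> max L L' / real k" "L' / real k \<le> max L L' / real k"
      by (simp_all add: divide_right_mono)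
    have "\<forall>U\<in>\<U> \<union> \<V>. \<forall>x\<in>U. \<forall>y\<in>U. dist x y \<le> max L L' / real k"
      using U(4) V(4) le by (meson UnE order_trans)
    then show ?thesis
      using card U V by (intro exI[of _ "\<U> \<union> \<V>"]) auto
  qed
  then show ?thesis
    unfolding box_content_finite_def using NL NL'
    by (intro exI[of _ "N + N'"] exI[of _ "max L L'"]) auto
qed

lemma box_content_finite_UN:
  assumes "finite I" "\<And>i. i \<in> I \<Longrightarrow> box_content_finite e (A i)"
  shows "box_content_finite e (\<Union>i\<in>I. A i)"
  using assms by (induction I) (auto intro: box_content_finite_empty box_content_finite_Un)

lemma box_content_finite_lipschitz_image:
  assumes "box_content_finite e A" "0 \<le> K"
    and lip: "\<And>x y. dist (f x) (f y) \<le> K * dist x y"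
  shows "box_content_finite e (f ` A)"
proof -
  obtain N L where NL: "0 \<le> N" "0 \<le> L" and
    A: "\<And>k. k \<ge> 1 \<Longrightarrow> \<exists>\<U>. finite \<U> \<and> A \<subseteq> \<Union>\<U> \<and> real (card \<U>) \<le> N * real k ^ e \<and>
          (\<forall>U\<in>\<U>. \<forall>x\<in>U. \<forall>y\<in>U. dist x y \<le> L / real k)"
    using assms(1) unfolding box_content_finite_def by blast
  have "\<exists>\<U>. finite \<U> \<and> f ` A \<subseteq> \<Union>\<U> \<and> real (card \<U>) \<le> N * real k ^ e \<and>
          (\<forall>U\<in>\<U>. \<forall>x\<in>U. \<forall>y\<in>U. dist x y \<le> (K * L) / real k)" if k: "k \<ge> 1" for k
  proof -
    obtain \<U> where U: "finite \<U>" "A \<subseteq> \<Union>\<U>" "real (card \<U>) \<le> N * real k ^ e"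
        "\<forall>U\<in>\<U>. \<forall>x\<in>U. \<forall>y\<in>U. dist x y \<le> L / real k"
      using A[OF k] by blast
    have "real (card ((`) f ` \<U>)) \<le> N * real k ^ e"
      using card_image_le[OF U(1), of "(`) f"] U(3) by linarith
    moreover have "dist (f x) (f y) \<le> (K * L) / real k" if "U \<in> \<U>" "x \<in> U" "y \<in> U" for U x y
    proof -
      have "dist (f x) (f y) \<le> K * dist x y" by (rule lip)
      also have "\<dots> \<le> K * (L / real k)"
        using U(4) that \<open>0 \<le> K\<close> by (intro mult_left_mono) auto
      finally show ?thesis by simp
    qed
    moreover have "f ` A \<subseteq> \<Union>((`) f ` \<U>)"
      using U(2) by blast
    ultimately show ?thesis
      using U(1) by (intro exI[of _ "(`) f ` \<U>"]) auto
  qed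
  then show ?thesis
    unfolding box_content_finite_def using NL \<open>0 \<le> K\<close>
    by (intro exI[of _ N] exI[of _ "K * L"]) auto
qed

text \<open>The basic example: a cube in the coordinates \<open>J\<close>, all other coordinates being fixed.\<close>

lemma box_content_finite_cube:
  fixes p :: "'a::euclidean_space"
  assumes J: "J \<subseteq> Basis"
  shows "box_content_finite (card J)
    {t. (\<forall>b\<in>J. \<bar>t \<bullet> b\<bar> \<le> 1) \<and> (\<forall>b\<in>Basis - J. t \<bullet> b = p \<bullet> b)}" (is "box_content_finite ?e ?T")
proof -
  have finJ: "finite J" using J finite_Basis finite_subset by blast
  have "\<exists>\<U>. finite \<U> \<and> ?T \<subseteq> \<Union>\<U> \<and> real (card \<U>) \<le> 3 ^ ?e * real k ^ ?e \<and>
          (\<forall>U\<in>\<U>. \<forall>x\<in>U. \<forall>y\<in>U. dist x y \<le> real ?e / real k)" if k: "k \<ge> 1" for k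
  proof -
    \<comment> \<open>The cells of a grid of mesh \<open>1 / k\<close>; the index \<open>2 * k\<close> occurs only for the coordinate \<open>1\<close>.\<close>
    define G where "G = (\<Pi>\<^sub>E b\<in>J. {..2 * k})"
    define U where "U g = {t \<in> ?T. \<forall>b\<in>J. real (g b) \<le> real k * (t \<bullet> b + 1) \<and>
        real k * (t \<bullet> b + 1) < real (g b) + 1}" for g :: "'a \<Rightarrow> nat"
    have finG: "finite G" unfolding G_def using finJ by (intro finite_PiE) auto
    have "card G = (2 * k + 1) ^ ?e"
      unfolding G_def using finJ by (simp add: card_PiE)
    also have "\<dots> \<le> (3 * k) ^ ?e"
      using k by (intro power_mono) auto
    finally have "card (U ` G) \<le> 3 ^ ?e * k ^ ?e"
      using card_image_le[OF finG, of U] by (simp add: power_mult_distrib)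
    then have card: "real (card (U ` G)) \<le> 3 ^ ?e * real k ^ ?e"
      using of_nat_mono[of "card (U ` G)" "3 ^ ?e * k ^ ?e", where 'a = real] by simp
    have cov: "?T \<subseteq> \<Union>(U ` G)"
    proof
      fix t assume t: "t \<in> ?T"
      define g where "g = restrict (\<lambda>b. nat \<lfloor>real k * (t \<bullet> b + 1)\<rfloor>) J"
      have *: "real (g b) \<le> real k * (t \<bullet> b + 1) \<and> real k * (t \<bullet> b + 1) < real (g b) + 1 \<and>
          g b \<le> 2 * k" if "b \<in> J" for b
      proof -
        have 1: "0 \<le> t \<bullet> b + 1" "t \<bullet> b + 1 \<le> 2" using t that by (auto simp: abs_le_iff)
        then have 2: "0 \<le> real k * (t \<bullet> b + 1)" "real k * (t \<bullet> b + 1) \<le> real (2 * k)"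
          using mult_left_mono[of "t \<bullet> b + 1" 2 "real k"] by auto
        then have "g b = nat \<lfloor>real k * (t \<bullet> b + 1)\<rfloor>" "0 \<le> \<lfloor>real k * (t \<bullet> b + 1)\<rfloor>"
          using that by (auto simp: g_def)
        then have "real (g b) = of_int \<lfloor>real k * (t \<bullet> b + 1)\<rfloor>" by simp
        then have "real (g b) \<le> real k * (t \<bullet> b + 1)" "real k * (t \<bullet> b + 1) < real (g b) + 1"
          by linarith+
        moreover from this have "g b \<le> 2 * k" using 2 by linarith
        ultimately show ?thesis by blast
      qed
      then have "g \<in> G" by (auto simp: G_def g_def PiE_def)
      moreover have "t \<in> U g" unfolding U_def using t * by blast
      ultimately show "t \<in> \<Union>(U ` G)" by blast
    qed
    have diam: "dist x y \<le> real ?e / real k" if "x \<in> U g" "y \<in> U g" for g x y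
    proof -
      have "dist x y \<le> (\<Sum>b\<in>Basis. \<bar>(x - y) \<bullet> b\<bar>)"
        unfolding dist_norm by (rule norm_le_l1)
      also have "\<dots> = (\<Sum>b\<in>J. \<bar>(x - y) \<bullet> b\<bar>)"
      proof (rule sum.mono_neutral_right[OF finite_Basis J], rule ballI)
        fix b assume "b \<in> Basis - J"
        then have "x \<bullet> b = p \<bullet> b" "y \<bullet> b = p \<bullet> b"
          using that unfolding U_def by blast+
        then show "\<bar>(x - y) \<bullet> b\<bar> = 0" by (simp add: inner_diff_left)
      qed
      also have "\<dots> \<le> (\<Sum>b\<in>J. 1 / real k)"
      proof (rule sum_mono)
        fix b assume "b \<in> J"
        then have "real (g b) \<le> real k * (x \<bullet> b + 1)" "real k * (x \<bullet> b + 1) < real (g b) + 1"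
          "real (g b) \<le> real k * (y \<bullet> b + 1)" "real k * (y \<bullet> b + 1) < real (g b) + 1"
          using that by (auto simp: U_def)
        then have "\<bar>real k * (x \<bullet> b + 1) - real k * (y \<bullet> b + 1)\<bar> \<le> 1" by linarith
        also have "real k * (x \<bullet> b + 1) - real k * (y \<bullet> b + 1) = real k * ((x - y) \<bullet> b)"
          by (simp add: algebra_simps)
        finally show "\<bar>(x - y) \<bullet> b\<bar> \<le> 1 / real k"
          using k by (simp add: abs_mult field_simps)
      qed
      finally show ?thesis by simp
    qed
    show ?thesis
      using finG card cov diam by (intro exI[of _ "U ` G"] conjI) auto
  qed
  then show ?thesis
    unfolding box_content_finite_def
    by (intro exI[of _ "3 ^ ?e"] exI[of _ "real ?e"]) auto
qed

text \<open>
  A hyperplane through the origin is a graph over the coordinates other than some \<open>i\<close>. Its unit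
  sphere is therefore the image of the boundary of a cube of dimension \<open>n - 1\<close>, whose facets have
  dimension \<open>n - 2\<close>, under a linear map followed by the radial projection; the latter is the
  nonexpansive projection onto the unit ball, since the lifted cube boundary does not meet its interior.
\<close>

lemma box_content_finite_great_subsphere:
  fixes w :: "'a::euclidean_space"
  assumes "w \<noteq> 0"
  shows "box_content_finite (DIM('a) - 2) {z \<in> sphere 0 1. w \<bullet> z = 0}"
proof -
  obtain i where i: "i \<in> Basis" "w \<bullet> i \<noteq> 0"
    using assms euclidean_all_zero_iff by blast
  define lift where "lift t = t - ((w \<bullet> t) / (w \<bullet> i)) *\<^sub>R i" for t
  define P where "P = closest_point (cball (0::'a) 1)"
  define T where "T j s = {t. (\<forall>b\<in>Basis - {i, j}. \<bar>t \<bullet> b\<bar> \<le> 1) \<and>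
      (\<forall>b\<in>Basis - (Basis - {i, j}). t \<bullet> b = (s *\<^sub>R j) \<bullet> b)}" for j :: 'a and s :: real
  have "linear lift"
    unfolding lift_def
    by (rule linearI) (simp_all add: inner_add_right add_divide_distrib scaleR_left_distrib
        algebra_simps)
  then obtain K where K: "K > 0" "\<And>t. norm (lift t) \<le> K * norm t"
    using linear_bounded_pos by blast
  have lip: "dist (P (lift x)) (P (lift y)) \<le> K * dist x y" for x y
  proof -
    have "dist (P (lift x)) (P (lift y)) \<le> dist (lift x) (lift y)"
      unfolding P_def by (rule closest_point_lipschitz) auto
    also have "\<dots> = norm (lift (x - y))"
      using \<open>linear lift\<close> by (simp add: dist_norm linear_diff)
    also have "\<dots> \<le> K * dist x y" using K(2) by (simp add: dist_norm)
    finally show ?thesis .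
  qed
  have P: "P z = z /\<^sub>R norm z" if "norm z \<ge> 1" for z
  proof -
    have "dist z (z /\<^sub>R norm z) \<le> dist z y" if "y \<in> cball 0 1" for y
    proof -
      have "z - z /\<^sub>R norm z = (1 - 1 / norm z) *\<^sub>R z"
        by (simp add: scaleR_diff_left divide_inverse)
      then have "dist z (z /\<^sub>R norm z) = \<bar>1 - 1 / norm z\<bar> * norm z"
        by (simp add: dist_norm)
      also have "\<dots> = (1 - 1 / norm z) * norm z"
        using \<open>norm z \<ge> 1\<close> by (subst abs_of_nonneg) (auto simp: divide_le_eq_1)
      also have "\<dots> = norm z - 1"
        using \<open>norm z \<ge> 1\<close> by (auto simp: left_diff_distrib)
      also have "\<dots> \<le> norm z - norm y" using that by simp
      also have "\<dots> \<le> dist z y" by (simp add: dist_norm norm_triangle_ineq2)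
      finally show ?thesis .
    qed
    moreover have "z \<noteq> 0" using that by auto
    ultimately have "z /\<^sub>R norm z = closest_point (cball 0 1) z"
      by (intro closest_point_unique) auto
    then show ?thesis by (simp add: P_def)
  qed
  \<comment> \<open>A point of the subsphere is projected to the coordinates other than \<open>i\<close> and then scaled to the
      boundary of the cube; \<open>j\<close> is the coordinate of largest modulus.\<close>
  have "{z \<in> sphere 0 1. w \<bullet> z = 0} \<subseteq>
      (\<Union>(j, s) \<in> (Basis - {i}) \<times> {-1, 1}. (\<lambda>t. P (lift t)) ` T j s)"
  proof
    fix z assume "z \<in> {z \<in> sphere 0 1. w \<bullet> z = 0}"
    then have z: "norm z = 1" "w \<bullet> z = 0" by auto
    define y where "y = z - (z \<bullet> i) *\<^sub>R i"
    have lift_y: "lift y = z"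
      using z i by (simp add: lift_def y_def inner_diff_right)
    have y_i: "y \<bullet> i = 0" using i by (simp add: y_def inner_diff_left)
    have "y \<noteq> 0"
      using z lift_y \<open>linear lift\<close> linear_0 by fastforce
    then obtain j0 where j0: "j0 \<in> Basis" "y \<bullet> j0 \<noteq> 0"
      using euclidean_all_zero_iff by blast
    then have nonempty: "Basis - {i} \<noteq> {}" using y_i by auto
    let ?A = "(\<lambda>b. \<bar>y \<bullet> b\<bar>) ` (Basis - {i})"
    have "Max ?A \<in> ?A"
      by (rule Max_in) (use nonempty in simp_all)
    then obtain j where max_j: "Max ?A = \<bar>y \<bullet> j\<bar>" and j: "j \<in> Basis - {i}"
      by (rule imageE)
    have jmax: "\<bar>y \<bullet> b\<bar> \<le> \<bar>y \<bullet> j\<bar>" if "b \<in> Basis - {i}" for b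
      unfolding max_j[symmetric] by (rule Max_ge) (use that in simp_all)
    define m where "m = \<bar>y \<bullet> j\<bar>"
    have "m > 0"
      using jmax[of j0] j0 y_i unfolding m_def by fastforce
    define t where "t = y /\<^sub>R m"
    have t_j: "\<bar>t \<bullet> j\<bar> = 1" using \<open>m > 0\<close> by (simp add: t_def m_def abs_mult)
    have "lift t = z /\<^sub>R m" using \<open>linear lift\<close> by (simp add: t_def linear_scale lift_y)
    have "lift t \<bullet> j = t \<bullet> j"
      using i j by (auto simp: lift_def inner_diff_left inner_Basis)
    then have "norm (lift t) \<ge> 1"
      using t_j j Basis_le_norm[of j "lift t"] by auto
    then have "P (lift t) = z"
      using \<open>m > 0\<close> z by (simp add: P \<open>lift t = z /\<^sub>R m\<close>)
    moreover have "t \<in> T j (t \<bullet> j)"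
    proof -
      have "\<bar>t \<bullet> b\<bar> \<le> 1" if "b \<in> Basis - {i, j}" for b
        using jmax[of b] that \<open>m > 0\<close> by (simp add: t_def m_def abs_mult field_simps)
      moreover have "t \<bullet> i = 0" by (simp add: t_def y_i)
      ultimately show ?thesis
        using i j by (auto simp: T_def inner_Basis)
    qed
    moreover have "t \<bullet> j \<in> {-1, 1}" using t_j by auto
    ultimately show "z \<in> (\<Union>(j, s) \<in> (Basis - {i}) \<times> {-1, 1}. (\<lambda>t. P (lift t)) ` T j s)"
      using j by blast
  qed
  moreover have "box_content_finite (DIM('a) - 2)
      (\<Union>(j, s) \<in> (Basis - {i}) \<times> {-1, 1}. (\<lambda>t. P (lift t)) ` T j s)"
  proof (rule box_content_finite_UN)
    fix q :: "'a \<times> real" assume "q \<in> (Basis - {i}) \<times> {-1, 1}"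
    then obtain j s where q: "q = (j, s)" "j \<in> Basis" "j \<noteq> i" by auto
    have "card (Basis - {i, j}) = DIM('a) - 2"
      using i q by (subst card_Diff_subset) auto
    then have "box_content_finite (DIM('a) - 2) (T j s)"
      unfolding T_def using box_content_finite_cube[of "Basis - {i, j}" "s *\<^sub>R j"] by auto
    then show "box_content_finite (DIM('a) - 2) (case q of (j, s) \<Rightarrow> (\<lambda>t. P (lift t)) ` T j s)"
      unfolding q prod.case
      by (rule box_content_finite_lipschitz_image[of _ _ K]) (use K lip in auto)
  qed auto
  ultimately show ?thesis
    by (rule box_content_finite_subset[rotated])
qed

text \<open>
  Dimension one is separate, because \<open>DIM('a) - 2\<close> is truncated there; the subsphere is empty then.
\<close>

lemma hausdorff_measure_great_subsphere:
  fixes w :: "'a::euclidean_space"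
  assumes "w \<noteq> 0"
  shows "hausdorff_measure (DIM('a) - 1) {z \<in> sphere 0 1. w \<bullet> z = 0} = 0"
proof (cases "DIM('a) = 1")
  case True
  have empty: "{z \<in> sphere 0 1. w \<bullet> z = 0} = {}"
  proof safe
    fix z assume z: "z \<in> sphere 0 1" "w \<bullet> z = 0"
    obtain b :: 'a where b: "Basis = {b}" using True card_1_singletonE by blast
    have repr: "x = (x \<bullet> b) *\<^sub>R b" for x
      using euclidean_representation[of x] by (simp add: b)
    have "w \<bullet> z = (w \<bullet> b) * (z \<bullet> b)"
      using euclidean_inner[of w z] by (simp add: b)
    moreover have "w \<bullet> b \<noteq> 0" using repr[of w] assms by auto
    ultimately have "z = 0" using z repr[of z] by simp
    then show "z \<in> {}" using z by simp
  qed
  have "hausdorff_premeasure d \<delta> ({} :: 'a set) = 0" if "0 < \<delta>" for d \<delta>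
    using hausdorff_premeasure_finite_cover[of "{}" "{} :: 'a set" 0 \<delta> d] that by simp
  then show ?thesis
    unfolding empty hausdorff_measure_def by simp
next
  case False
  then have "DIM('a) - 1 = Suc (DIM('a) - 2)"
    using DIM_positive[where 'a = 'a] by linarith
  then show ?thesis
    using hausdorff_measure_eq_0_if_box_content_finite
      box_content_finite_great_subsphere[OF assms] by metis
qed

lemma nonatomic_cost_AE_inner_nonzero:
  assumes "prob_space M" "nonatomic_cost M c" "w \<noteq> 0"
  shows "AE \<omega> in M. c \<omega> \<bullet> w \<noteq> 0"
proof -
  interpret prob_space M by fact
  have [measurable]: "c \<in> borel_measurable M" and sph: "\<And>\<omega>. \<omega> \<in> space M \<Longrightarrow> c \<omega> \<in> sphere 0 1"
    and null: "\<And>O1. O1 \<in> sets borel \<Longrightarrow> O1 \<subseteq> sphere 0 1 \<Longrightarrow>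
       hausdorff_measure (DIM('b) - 1) O1 = 0 \<Longrightarrow> prob {\<omega> \<in> space M. c \<omega> \<in> O1} = 0"
    using assms(2) unfolding nonatomic_cost_def by blast+
  have "{z \<in> sphere 0 1. w \<bullet> z = 0} = sphere 0 1 \<inter> {z. w \<bullet> z = 0}" by auto
  also have "\<dots> \<in> sets borel"
    by (intro borel_closed closed_Int closed_hyperplane closed_sphere)
  finally have "prob {\<omega> \<in> space M. c \<omega> \<in> {z \<in> sphere 0 1. w \<bullet> z = 0}} = 0"
    by (intro null hausdorff_measure_great_subsphere assms) auto
  also have "{\<omega> \<in> space M. c \<omega> \<in> {z \<in> sphere 0 1. w \<bullet> z = 0}} = {\<omega> \<in> space M. c \<omega> \<bullet> w = 0}"
    using sph by (auto simp: inner_commute)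
  finally have "prob {\<omega> \<in> space M. c \<omega> \<bullet> w = 0} = 0" .
  then show ?thesis
    by (subst AE_iff_measurable[OF _ refl]) (auto simp: emeasure_eq_measure)
qed

section \<open>Fibers of a polytope vary continuously\<close>

text \<open>
  Around each of its points, a polyhedron coincides with a cone: from \<open>x\<close> one can move a fixed
  distance \<open>r\<close> towards every other point.
\<close>

lemma polyhedron_locally_conic:
  fixes P :: "'a::euclidean_space set"
  assumes "polyhedron P" "x \<in> P"
  shows "\<exists>r>0. \<forall>x'\<in>P. x' \<noteq> x \<longrightarrow> x + (r / norm (x' - x)) *\<^sub>R (x' - x) \<in> P"
proof -
  from assms(1) obtain H where
    "finite H \<and> P = \<Inter>H \<and> (\<forall>h\<in>H. \<exists>a b. a \<noteq> 0 \<and> h = {x. a \<bullet> x \<le> b})"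
    unfolding polyhedron_def by (rule exE)
  then have H: "finite H" "P = \<Inter>H" "\<forall>h\<in>H. \<exists>a b. a \<noteq> 0 \<and> h = {x. a \<bullet> x \<le> b}"
    by simp_all
  have "\<forall>\<^sub>F r in at_right 0. \<forall>x'\<in>h. x' \<noteq> x \<longrightarrow> x + (r / norm (x' - x)) *\<^sub>R (x' - x) \<in> h"
    if h: "h \<in> H" for h
  proof -
    obtain a b where ab: "a \<noteq> 0" "h = {x. a \<bullet> x \<le> b}" using H(3) h by blast
    have "a \<bullet> x \<le> b" using assms(2) h H(2) ab by auto
    show ?thesis
    proof (cases "a \<bullet> x = b")
      case True
      show ?thesis
        using eventually_at_right_less
      proof eventually_elim
        case (elim r)
        show ?case
        proof (intro ballI impI)
          fix x' assume x': "x' \<in> h" "x' \<noteq> x"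
          then have "a \<bullet> (x' - x) \<le> 0" using True ab by (simp add: inner_diff_right)
          then have "(r / norm (x' - x)) * (a \<bullet> (x' - x)) \<le> 0"
            using elim by (intro mult_nonneg_nonpos) auto
          then show "x + (r / norm (x' - x)) *\<^sub>R (x' - x) \<in> h"
            using True ab by (simp add: inner_add_right)
        qed
      qed
    next
      case False
      then have "0 < (b - a \<bullet> x) / norm a" using \<open>a \<bullet> x \<le> b\<close> ab by simp
      then have "\<forall>\<^sub>F r in at_right 0. r < (b - a \<bullet> x) / norm a"
        using eventually_at_right_field by blast
      then show ?thesis
        using eventually_at_right_less
      proof eventually_elim
        case (elim r)
        show ?case
        proof (intro ballI impI)
          fix x' assume x': "x' \<in> h" "x' \<noteq> x"
          have "a \<bullet> ((r / norm (x' - x)) *\<^sub>R (x' - x)) \<le> norm a * norm ((r / norm (x' - x)) *\<^sub>R (x' - x))"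
            by (rule norm_cauchy_schwarz)
          also have "\<dots> = norm a * r" using x' elim by simp
          also have "\<dots> \<le> b - a \<bullet> x" using elim ab by (simp add: field_simps)
          finally show "x + (r / norm (x' - x)) *\<^sub>R (x' - x) \<in> h"
            using ab by (simp add: inner_add_right)
        qed
      qed
    qed
  qed
  then have "\<forall>\<^sub>F r in at_right 0. \<forall>h\<in>H. \<forall>x'\<in>h. x' \<noteq> x \<longrightarrow>
      x + (r / norm (x' - x)) *\<^sub>R (x' - x) \<in> h"
    by (intro eventually_ball_finite[OF H(1)] ballI)
  moreover have "\<forall>\<^sub>F r in at_right (0::real). 0 < r" by (rule eventually_at_right_less)
  ultimately have "\<forall>\<^sub>F r in at_right (0::real). 0 < r \<and> (\<forall>h\<in>H. \<forall>x'\<in>h. x' \<noteq> x \<longrightarrow>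
      x + (r / norm (x' - x)) *\<^sub>R (x' - x) \<in> h)"
    by eventually_elim blast
  then obtain r where "0 < r" "\<forall>h\<in>H. \<forall>x'\<in>h. x' \<noteq> x \<longrightarrow>
      x + (r / norm (x' - x)) *\<^sub>R (x' - x) \<in> h"
    using eventually_happens' trivial_limit_at_right_real by blast
  then show ?thesis unfolding H(2) by (intro exI[of _ r]) auto
qed

text \<open>
  If \<open>p\<close> is the point at distance \<open>r\<close> from \<open>x\<close> towards \<open>x'\<close> and \<open>q\<close> is any point over \<open>p\<close>, then the
  segment from \<open>(x, z)\<close> to \<open>(p, q)\<close> passes over \<open>x'\<close> at a distance from \<open>z\<close> proportional to that of
  \<open>x'\<close> from \<open>x\<close>. For \<open>x'\<close> farther away than \<open>r\<close>, boundedness of \<open>D\<close> suffices.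
\<close>

lemma polytope_fiber_lipschitz_at:
  fixes D :: "('a::euclidean_space \<times> 'b::euclidean_space) set"
  assumes "polytope D" "(x, z) \<in> D"
  shows "\<exists>K\<ge>0. \<forall>x'\<in>fst ` D. \<exists>w. (x', w) \<in> D \<and> dist w z \<le> K * dist x' x"
proof -
  have "polyhedron (fst ` D)"
    by (rule polytope_imp_polyhedron[OF polytope_linear_image[OF linear_fst assms(1)]])
  moreover have "x \<in> fst ` D" using assms(2) by force
  ultimately have "\<exists>r>0. \<forall>x'\<in>fst ` D. x' \<noteq> x \<longrightarrow> x + (r / norm (x' - x)) *\<^sub>R (x' - x) \<in> fst ` D"
    by (rule polyhedron_locally_conic)
  then obtain r where "r > 0 \<and>
      (\<forall>x'\<in>fst ` D. x' \<noteq> x \<longrightarrow> x + (r / norm (x' - x)) *\<^sub>R (x' - x) \<in> fst ` D)"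
    by (rule exE)
  then have r: "r > 0"
    "\<And>x'. x' \<in> fst ` D \<Longrightarrow> x' \<noteq> x \<Longrightarrow> x + (r / norm (x' - x)) *\<^sub>R (x' - x) \<in> fst ` D"
    by blast+
  have "bounded (snd ` D)"
    using polytope_imp_bounded[OF assms(1)] by (rule bounded_snd)
  then obtain m where m: "\<And>w w'. w \<in> snd ` D \<Longrightarrow> w' \<in> snd ` D \<Longrightarrow> dist w w' \<le> m"
    using diameter_bounded_bound by metis
  have "m \<ge> 0" using m[of z z] assms(2) by force
  have "\<exists>w. (x', w) \<in> D \<and> dist w z \<le> m / r * dist x' x" if x': "x' \<in> fst ` D" for x'
  proof (cases "x' = x")
    case True
    then show ?thesis using assms(2) by (intro exI[of _ z]) simp
  next
    case False
    define n where "n = norm (x' - x)"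
    have "n > 0" using False by (simp add: n_def)
    show ?thesis
    proof (cases "n \<ge> r")
      case True
      obtain w where "(x', w) \<in> D" using x' by auto
      moreover have "dist w z \<le> m" using m[of w z] assms(2) \<open>(x', w) \<in> D\<close> by force
      moreover have "m \<le> m / r * n" using True r(1) \<open>m \<ge> 0\<close> by (simp add: field_simps mult_left_mono)
      ultimately show ?thesis unfolding dist_norm[of x'] n_def[symmetric] by (intro exI[of _ w]) auto
    next
      case False
      obtain q where q: "(x + (r / n) *\<^sub>R (x' - x), q) \<in> D"
        using r(2)[OF x' \<open>x' \<noteq> x\<close>] n_def by auto
      define t where "t = n / r"
      have t: "0 \<le> t" "t \<le> 1" using False \<open>n > 0\<close> r(1) by (auto simp: t_def)
      have "(1 - t) *\<^sub>R (x, z) + t *\<^sub>R (x + (r / n) *\<^sub>R (x' - x), q) \<in> D"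
        using polytope_imp_convex[OF assms(1)] assms(2) q t by (intro convexD) auto
      also have "(1 - t) *\<^sub>R (x, z) + t *\<^sub>R (x + (r / n) *\<^sub>R (x' - x), q) = (x', z + t *\<^sub>R (q - z))"
        using \<open>n > 0\<close> r(1) by (simp add: t_def algebra_simps)
      finally have "(x', z + t *\<^sub>R (q - z)) \<in> D" .
      moreover have "dist (z + t *\<^sub>R (q - z)) z \<le> m / r * n"
      proof -
        have "dist (z + t *\<^sub>R (q - z)) z = t * dist q z" using t by (simp add: dist_norm)
        also have "\<dots> \<le> t * m"
          using m[of q z] assms(2) q t by (intro mult_left_mono) force+
        finally show ?thesis by (simp add: t_def mult.commute)
      qed
      ultimately show ?thesis unfolding dist_norm[of x'] n_def[symmetric] by blast
    qed
  qed
  then show ?thesis using \<open>m \<ge> 0\<close> r(1) by (intro exI[of _ "m / r"]) auto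
qed

lemma polytope_fiber_sequence:
  fixes D :: "('a::euclidean_space \<times> 'b::euclidean_space) set"
  assumes "polytope D" "(x, z) \<in> D" "\<And>k. u k \<in> fst ` D" "u \<longlonglongrightarrow> x"
  shows "\<exists>w. (\<forall>k. (u k, w k) \<in> D) \<and> w \<longlonglongrightarrow> z"
proof -
  obtain K where K: "K \<ge> 0" "\<And>x'. x' \<in> fst ` D \<Longrightarrow> \<exists>w. (x', w) \<in> D \<and> dist w z \<le> K * dist x' x"
    using polytope_fiber_lipschitz_at[OF assms(1,2)] by blast
  then have "\<exists>w. \<forall>k. (u k, w k) \<in> D \<and> dist (w k) z \<le> K * dist (u k) x"
    using assms(3) by (intro choice) blast
  then obtain w where w: "\<And>k. (u k, w k) \<in> D" "\<And>k. dist (w k) z \<le> K * dist (u k) x" by blast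
  have "(\<lambda>k. K * dist (u k) x) \<longlonglongrightarrow> 0"
    using tendsto_mult_right_zero[OF tendsto_dist_iff[THEN iffD1, OF assms(4)]] by blast
  then have "(\<lambda>k. dist (w k) z) \<longlonglongrightarrow> 0"
    by (rule tendsto_sandwich[OF _ _ tendsto_const, rotated 2]) (auto simp: w)
  then have "w \<longlonglongrightarrow> z" by (rule tendsto_dist_iff[THEN iffD2])
  then show ?thesis using w(1) by blast
qed

text \<open>
  Minimisers over the fibers depend continuously on the base point wherever they are unique: a limit
  point of minimisers is feasible, and it is a minimiser because every competitor in the limiting
  fiber is a limit of competitors.
\<close>

lemma fiber_minimisers_converge:
  fixes D :: "('a::euclidean_space \<times> 'b::euclidean_space) set"
  assumes "polytope D" "\<And>k. u k \<in> fst ` D" "u \<longlonglongrightarrow> x"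
    and y: "\<And>k. (u k, y k) \<in> D" "\<And>k w. (u k, w) \<in> D \<Longrightarrow> e \<bullet> y k \<le> e \<bullet> w"
    and uniq: "\<And>v. (x, v) \<in> D \<Longrightarrow> (\<And>w. (x, w) \<in> D \<Longrightarrow> e \<bullet> v \<le> e \<bullet> w) \<Longrightarrow> v = y0"
  shows "y \<longlonglongrightarrow> y0"
proof (rule ccontr)
  assume "\<not> y \<longlonglongrightarrow> y0"
  then obtain \<epsilon> where \<epsilon>: "\<epsilon> > 0" "\<exists>\<^sub>F k in sequentially. \<not> dist (y k) y0 < \<epsilon>"
    unfolding tendsto_iff frequently_def by auto
  then have "infinite {k. \<not> dist (y k) y0 < \<epsilon>}"
    by (simp add: frequently_cofinite[symmetric] cofinite_eq_sequentially)
  then obtain r :: "nat \<Rightarrow> nat" where r: "strict_mono r" "\<And>k. r k \<in> {k. \<not> dist (y k) y0 < \<epsilon>}"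
    using infinite_enumerate by blast
  have "compact D" using assms(1) polytope_imp_compact by blast
  then obtain l s where l: "l \<in> D" "strict_mono s" "((\<lambda>k. (u (r k), y (r k))) \<circ> s) \<longlonglongrightarrow> l"
    using y(1) unfolding compact_def by (metis (no_types, lifting))
  define q where "q = r \<circ> s"
  have q: "strict_mono q" unfolding q_def using r(1) l(2) by (rule strict_mono_o)
  have lim: "(\<lambda>k. (u (q k), y (q k))) \<longlonglongrightarrow> l" using l(3) by (simp add: q_def o_def)
  have lim_u: "(\<lambda>k. u (q k)) \<longlonglongrightarrow> x"
    using LIMSEQ_subseq_LIMSEQ[OF assms(3) q] by (simp add: o_def)
  have "fst l = x"
    using tendsto_fst[OF lim] lim_u LIMSEQ_unique by force
  then obtain v where v: "l = (x, v)" by (metis prod.collapse)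
  have lim_y: "(\<lambda>k. y (q k)) \<longlonglongrightarrow> v" using tendsto_snd[OF lim] by (simp add: v)
  have "v = y0"
  proof (rule uniq)
    show "(x, v) \<in> D" using l(1) v by simp
    fix w assume "(x, w) \<in> D"
    then obtain w' where w': "\<And>k. (u (q k), w' k) \<in> D" "w' \<longlonglongrightarrow> w"
      using polytope_fiber_sequence[OF assms(1), of x w "\<lambda>k. u (q k)"] assms(2) lim_u by blast
    have "(\<lambda>k. e \<bullet> y (q k)) \<longlonglongrightarrow> e \<bullet> v" "(\<lambda>k. e \<bullet> w' k) \<longlonglongrightarrow> e \<bullet> w"
      using lim_y w'(2) by (auto intro: tendsto_intros)
    then show "e \<bullet> v \<le> e \<bullet> w"
      by (rule LIMSEQ_le) (use y(2) w'(1) in blast)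
  qed
  then have "(\<lambda>k. dist (y (q k)) y0) \<longlonglongrightarrow> 0"
    using lim_y tendsto_dist_iff[of "\<lambda>k. y (q k)"] by simp
  then have "\<forall>\<^sub>F k in sequentially. dist (y (q k)) y0 < \<epsilon>"
    using \<epsilon>(1) by (rule order_tendstoD)
  then obtain k where "dist (y (q k)) y0 < \<epsilon>"
    using eventually_happens' sequentially_bot by blast
  then show False using r(2)[of "s k"] by (simp add: q_def)
qed

section \<open>Faces, chambers and minimisers over fibers\<close>

text \<open>For a polytope, every nonempty face is exposed, so the two notions of face agree.\<close>

lemma faces_iff_face_of:
  fixes D :: "'a::euclidean_space set"
  assumes "polytope D" "D \<noteq> {}"
  shows "F \<in> faces D \<longleftrightarrow> F face_of D \<and> F \<noteq> {}"
proof
  assume "F \<in> faces D"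
  then obtain d where F: "F = {z \<in> D. \<forall>w\<in>D. d \<bullet> w \<le> d \<bullet> z}" unfolding faces_def by blast
  have "continuous_on D (\<lambda>w. d \<bullet> w)" by (intro continuous_intros)
  then obtain z where z: "z \<in> D" "\<And>w. w \<in> D \<Longrightarrow> d \<bullet> w \<le> d \<bullet> z"
    using continuous_attains_sup[OF polytope_imp_compact[OF assms(1)] assms(2), of "\<lambda>w. d \<bullet> w"]
    by blast
  have "F = D \<inter> {w. d \<bullet> w = d \<bullet> z}"
    using z unfolding F by (auto intro: antisym)
  then show "F face_of D \<and> F \<noteq> {}"
    using face_of_Int_supporting_hyperplane_le[OF polytope_imp_convex[OF assms(1)] z(2)] z(1)
    by auto
next
  assume F: "F face_of D \<and> F \<noteq> {}"
  then have "F exposed_face_of D"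
    using exposed_face_of_polyhedron[OF polytope_imp_polyhedron[OF assms(1)]] by blast
  then obtain d b where "D \<subseteq> {x. d \<bullet> x \<le> b}" "F = D \<inter> {x. d \<bullet> x = b}"
    unfolding exposed_face_of_def by blast
  then have "F = {z \<in> D. \<forall>w\<in>D. d \<bullet> w \<le> d \<bullet> z}"
    using F by (auto intro: antisym)
  then show "F \<in> faces D" unfolding faces_def by blast
qed

lemma polytope_face_containing_in_rel_interior:
  fixes D :: "'a::euclidean_space set"
  assumes "polytope D" "z \<in> D"
  shows "\<exists>F\<in>faces D. z \<in> rel_interior F"
proof -
  \<comment> \<open>The smallest face containing \<open>z\<close>: a facet of it through \<open>z\<close> would be a smaller one.\<close>
  define F where "F = \<Inter>{F. F face_of D \<and> z \<in> F}"
  have D_face: "D face_of D" using polytope_imp_convex[OF assms(1)] by (rule face_of_refl)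
  have F: "F face_of D" unfolding F_def
    by (rule face_of_Inter) (use D_face assms(2) in auto)
  have "z \<in> F" by (auto simp: F_def)
  have "z \<in> rel_interior F"
  proof (rule ccontr)
    assume "z \<notin> rel_interior F"
    moreover have "polyhedron F"
      using face_of_polyhedron_polyhedron[OF polytope_imp_polyhedron[OF assms(1)] F] .
    ultimately obtain G where G: "G facet_of F" "z \<in> G"
      using rel_boundary_of_polyhedron \<open>z \<in> F\<close> by blast
    then have "G face_of D" using F facet_of_imp_face_of face_of_trans by blast
    then have "F \<subseteq> G" using G(2) by (auto simp: F_def)
    then have "F = G" using G(1) facet_of_imp_subset by blast
    then show False using G(1) by simp
  qed
  moreover have "F \<in> faces D"
    using faces_iff_face_of[OF assms(1)] F \<open>z \<in> F\<close> assms(2) by blast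
  ultimately show ?thesis by blast
qed

text \<open>
  If a minimiser over a fiber lies in the relative interior of a convex subset \<open>F\<close> of \<open>D\<close>, all points
  of \<open>F\<close> are minimisers over their fibers: an improvement at \<open>(x', v')\<close> could be averaged with a point
  of \<open>F\<close> beyond \<open>(x, v)\<close> into an improvement over \<open>x\<close>.
\<close>

lemma fiber_minimiser_propagates:
  fixes D :: "('a::euclidean_space \<times> 'b::euclidean_space) set"
  assumes "convex D" "convex F" "F \<subseteq> D" "(x, v) \<in> rel_interior F"
    and min: "\<And>w. (x, w) \<in> D \<Longrightarrow> e \<bullet> v \<le> e \<bullet> w"
    and "(x', v') \<in> F" "(x', w') \<in> D"
  shows "e \<bullet> v' \<le> e \<bullet> w'"
proof -
  have "(x', v') \<in> affine hull F" using assms(6) hull_inc by fast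
  then obtain s where s: "s > 1" "(1 - s) *\<^sub>R (x', v') + s *\<^sub>R (x, v) \<in> F"
    using convex_rel_interior_if2[OF assms(2,4)] by blast
  define p where "p = (1 - s) *\<^sub>R (x', v') + s *\<^sub>R (x, v)"
  have "p \<in> D" using s assms(3) by (auto simp: p_def)
  have "(1 - 1 / s) *\<^sub>R (x', w') + (1 / s) *\<^sub>R p \<in> D"
    using \<open>p \<in> D\<close> assms(1,7) s(1) by (intro convexD) auto
  also have "(1 - 1 / s) *\<^sub>R (x', w') + (1 / s) *\<^sub>R p = (x, v + (1 - 1 / s) *\<^sub>R (w' - v'))"
    using s(1) by (simp add: p_def algebra_simps add_divide_distrib diff_divide_distrib)
  finally have "e \<bullet> v \<le> e \<bullet> (v + (1 - 1 / s) *\<^sub>R (w' - v'))" by (rule min)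
  then have "0 \<le> (1 - 1 / s) * (e \<bullet> w' - e \<bullet> v')"
    by (simp add: inner_add_right inner_diff_right)
  moreover have "1 - 1 / s > 0" using s(1) by simp
  ultimately show ?thesis by (simp add: zero_le_mult_iff)
qed

lemma mem_chamber_iff:
  "x' \<in> chamber D x \<longleftrightarrow> (\<forall>F\<in>faces D. x \<in> fst ` F \<longrightarrow> x' \<in> fst ` F)"
  by (auto simp: chamber_def)

lemma mem_chamber_self: "x \<in> chamber D x"
  by (simp add: mem_chamber_iff)

text \<open>A nonempty polytope in a product space; its chambers live in the projection to the first factor.\<close>

locale polytope_chambers =
  fixes D :: "('a::euclidean_space \<times> 'b::euclidean_space) set"
  assumes polytope_D: "polytope D" and D_nonempty: "D \<noteq> {}"
begin

lemma convex_D: "convex D" and compact_D: "compact D"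
  using polytope_D by (auto intro: polytope_imp_convex polytope_imp_compact)

lemma face_subset: "F \<in> faces D \<Longrightarrow> F \<subseteq> D"
  by (auto simp: faces_def)

lemma convex_face: "F \<in> faces D \<Longrightarrow> convex F"
  using faces_iff_face_of[OF polytope_D D_nonempty] face_of_imp_convex by blast

lemma compact_face: "F \<in> faces D \<Longrightarrow> compact F"
  using faces_iff_face_of[OF polytope_D D_nonempty] face_of_imp_compact convex_D compact_D by blast

lemma finite_faces: "finite (faces D)"
  by (rule finite_subset[OF _ finite_polytope_faces[OF polytope_D]])
     (use faces_iff_face_of[OF polytope_D D_nonempty] in auto)

lemma D_in_faces: "D \<in> faces D"
  unfolding faces_def by (auto intro!: exI[of _ 0])

lemma finite_chamber_complex: "finite (chamber_complex D)"
proof -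
  have "chamber_complex D \<subseteq> Inter ` Pow ((`) fst ` faces D)"
    unfolding chamber_complex_def chamber_def by blast
  then show ?thesis by (rule finite_subset) (simp add: finite_faces)
qed

lemma convex_chamber: "convex (chamber D x)"
  unfolding chamber_def
  by (rule convex_Inter) (auto intro: convex_linear_image convex_face linear_fst)

lemma chamber_subset: "x \<in> fst ` D \<Longrightarrow> chamber D x \<subseteq> fst ` D"
  using D_in_faces mem_chamber_iff by blast

lemma compact_chamber:
  assumes "x \<in> fst ` D"
  shows "compact (chamber D x)"
  unfolding chamber_def
proof (rule compact_Inter)
  show "compact T" if "T \<in> {fst ` F |F. F \<in> faces D \<and> x \<in> fst ` F}" for T
    using that compact_continuous_image[OF continuous_on_fst[OF continuous_on_id] compact_face]
    by auto
  show "{fst ` F |F. F \<in> faces D \<and> x \<in> fst ` F} \<noteq> {}"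
    using D_in_faces assms by blast
qed

lemma obtain_face:
  assumes "(x, v) \<in> D"
  obtains F where "F \<in> faces D" "(x, v) \<in> rel_interior F" "(x, v) \<in> F"
    "\<And>x'. x' \<in> chamber D x \<Longrightarrow> \<exists>v'. (x', v') \<in> F"
proof -
  obtain F where F: "F \<in> faces D" "(x, v) \<in> rel_interior F"
    using polytope_face_containing_in_rel_interior[OF polytope_D assms] by blast
  then have "(x, v) \<in> F" using rel_interior_subset by blast
  then have "x \<in> fst ` F" by force
  then have "x' \<in> fst ` F" if "x' \<in> chamber D x" for x'
    using that F(1) mem_chamber_iff by blast
  then have "\<exists>v'. (x', v') \<in> F" if "x' \<in> chamber D x" for x'
    using that by force
  then show ?thesis using that F \<open>(x, v) \<in> F\<close> by blast
qed

lemma obtain_fiber_minimiser: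
  assumes "x \<in> fst ` D"
  obtains v where "(x, v) \<in> D" "\<And>w. (x, w) \<in> D \<Longrightarrow> e \<bullet> v \<le> e \<bullet> w"
proof -
  have "compact (D \<inter> ({x} \<times> UNIV))"
    by (intro compact_Int_closed compact_D closed_Times) auto
  moreover have "D \<inter> ({x} \<times> UNIV) \<noteq> {}" using assms by auto
  moreover have "continuous_on (D \<inter> ({x} \<times> UNIV)) (\<lambda>p. e \<bullet> snd p)"
    by (intro continuous_intros)
  ultimately have "\<exists>p\<in>D \<inter> ({x} \<times> UNIV). \<forall>q\<in>D \<inter> ({x} \<times> UNIV). e \<bullet> snd p \<le> e \<bullet> snd q"
    by (rule continuous_attains_inf)
  then obtain p where p: "p \<in> D \<inter> ({x} \<times> UNIV)"
    "\<And>q. q \<in> D \<inter> ({x} \<times> UNIV) \<Longrightarrow> e \<bullet> snd p \<le> e \<bullet> snd q"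
    by (rule bexE) (use that in blast)
  show ?thesis
  proof (rule that[of "snd p"])
    show "(x, snd p) \<in> D" using p(1) by auto
    show "e \<bullet> snd p \<le> e \<bullet> w" if "(x, w) \<in> D" for w
      using p(2)[of "(x, w)"] that by simp
  qed
qed

lemma mem_rel_interior_chamber:
  assumes "x \<in> fst ` D"
  shows "x \<in> rel_interior (chamber D x)"
proof -
  define \<F> where "\<F> = {fst ` F | F. F \<in> faces D \<and> x \<in> rel_interior (fst ` F)}"
  \<comment> \<open>Every face above \<open>x\<close> contains a smaller one whose projection has \<open>x\<close> in its relative interior,
      so that the chamber is already the intersection of the latter projections.\<close>
  have "chamber D x = \<Inter>\<F>"
  proof
    show "chamber D x \<subseteq> \<Inter>\<F>"
      unfolding chamber_def \<F>_def
    proof (rule Inter_anti_mono, rule subsetI)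
      fix T assume "T \<in> {fst ` F | F. F \<in> faces D \<and> x \<in> rel_interior (fst ` F)}"
      then obtain F where "F \<in> faces D" "x \<in> rel_interior (fst ` F)" "T = fst ` F" by auto
      then show "T \<in> {fst ` F | F. F \<in> faces D \<and> x \<in> fst ` F}"
        using rel_interior_subset[of "fst ` F"] by auto
    qed
    show "\<Inter>\<F> \<subseteq> chamber D x"
    proof
      fix x' assume x': "x' \<in> \<Inter>\<F>"
      have "x' \<in> fst ` F" if F: "F \<in> faces D" "x \<in> fst ` F" for F
      proof -
        obtain v where v: "(x, v) \<in> F" using F(2) by auto
        have F_face: "F face_of D"
          using F(1) faces_iff_face_of[OF polytope_D D_nonempty] by blast
        then have "polytope F" using face_of_polytope_polytope polytope_D by blast
        then obtain G where G: "G \<in> faces F" "(x, v) \<in> rel_interior G"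
          using polytope_face_containing_in_rel_interior v by blast
        have "G face_of F" "G \<noteq> {}"
          using faces_iff_face_of[OF \<open>polytope F\<close>] G(1) v by blast+
        then have "G \<in> faces D"
          using F_face faces_iff_face_of[OF polytope_D D_nonempty] face_of_trans by blast
        moreover have "x \<in> rel_interior (fst ` G)"
          using rel_interior_convex_linear_image[OF linear_fst convex_face[OF \<open>G \<in> faces D\<close>]] G(2)
          by force
        ultimately have "x' \<in> fst ` G" using x' by (auto simp: \<F>_def)
        then show ?thesis using \<open>G face_of F\<close> face_of_imp_subset by blast
      qed
      then show "x' \<in> chamber D x" by (simp add: mem_chamber_iff)
    qed
  qed
  moreover have "rel_interior (\<Inter>\<F>) = \<Inter>(rel_interior ` \<F>)"
  proof (rule convex_rel_interior_finite_Inter)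
    show "convex S" if "S \<in> \<F>" for S
      using that by (auto simp: \<F>_def intro: convex_linear_image convex_face linear_fst)
    show "\<Inter>(rel_interior ` \<F>) \<noteq> {}" by (auto simp: \<F>_def)
    have "\<F> \<subseteq> (`) fst ` faces D" by (auto simp: \<F>_def)
    then show "finite \<F>" using finite_faces finite_subset by blast
  qed
  moreover have "x \<in> \<Inter>(rel_interior ` \<F>)" by (auto simp: \<F>_def)
  ultimately show ?thesis by simp
qed

text \<open>
  Let \<open>G\<close> be the face maximising \<open>(d1, d2)\<close>, and let \<open>x\<close> lie in its projection. By propagation, the
  maximum of \<open>d2\<close> over the fibers is an affine function on the chamber of \<open>x0\<close>; adding \<open>d1\<close> gives an
  affine function there which attains its upper bound at the relative interior point \<open>x\<close>, hence also
  at \<open>x0\<close>. So \<open>x0\<close> lies in the projection of \<open>G\<close>, too.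
\<close>

lemma chamber_eq_if_mem_rel_interior:
  assumes "x0 \<in> fst ` D" and x: "x \<in> rel_interior (chamber D x0)"
  shows "chamber D x = chamber D x0"
proof
  have "x \<in> chamber D x0" using x rel_interior_subset by blast
  then show "chamber D x \<subseteq> chamber D x0" by (auto simp: mem_chamber_iff)
  have "x0 \<in> affine hull chamber D x0" using mem_chamber_self hull_inc by fast
  then obtain s where s: "s > 1" "(1 - s) *\<^sub>R x0 + s *\<^sub>R x \<in> chamber D x0"
    using convex_rel_interior_if2[OF convex_chamber x] by blast
  define x1 where "x1 = (1 - s) *\<^sub>R x0 + s *\<^sub>R x"
  have x_eq: "x = (1 - 1 / s) *\<^sub>R x0 + (1 / s) *\<^sub>R x1"
    using s(1) by (simp add: x1_def algebra_simps)
  have "x0 \<in> fst ` G" if G: "G \<in> faces D" "x \<in> fst ` G" for G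
  proof -
    obtain d where d: "G = {z \<in> D. \<forall>w\<in>D. d \<bullet> w \<le> d \<bullet> z}" using G(1) by (auto simp: faces_def)
    obtain v where v: "(x, v) \<in> G" using G(2) by auto
    obtain d1 d2 where d12: "d = (d1, d2)" by (cases d)
    obtain v0 where v0: "(x0, v0) \<in> D" "\<And>w. (x0, w) \<in> D \<Longrightarrow> (- d2) \<bullet> v0 \<le> (- d2) \<bullet> w"
      using obtain_fiber_minimiser[OF assms(1), of "- d2"] by metis
    obtain F where F: "F \<in> faces D" "(x0, v0) \<in> rel_interior F" "(x0, v0) \<in> F"
      "\<And>x'. x' \<in> chamber D x0 \<Longrightarrow> \<exists>v'. (x', v') \<in> F"
      using obtain_face[OF v0(1)] by metis
    obtain v1 where v1: "(x1, v1) \<in> F" using F(4) s(2) by (auto simp: x1_def)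
    define w where "w = (1 - 1 / s) *\<^sub>R v0 + (1 / s) *\<^sub>R v1"
    have xw: "(x, w) = (1 - 1 / s) *\<^sub>R (x0, v0) + (1 / s) *\<^sub>R (x1, v1)"
      by (simp add: w_def x_eq)
    have "(x, w) \<in> F"
      unfolding xw using convex_face[OF F(1)] F(3) v1 s(1) by (intro convexD) auto
    then have "(- d2) \<bullet> w \<le> (- d2) \<bullet> v"
      using fiber_minimiser_propagates[OF convex_D convex_face[OF F(1)] face_subset[OF F(1)] F(2) v0(2)]
        v d by blast
    then have "d \<bullet> (x, v) \<le> d \<bullet> (x, w)" by (simp add: d12)
    also have "\<dots> = (1 - 1 / s) * (d \<bullet> (x0, v0)) + (1 / s) * (d \<bullet> (x1, v1))"
      unfolding xw by (simp only: inner_add_right inner_scaleR_right)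
    also have "\<dots> \<le> (1 - 1 / s) * (d \<bullet> (x0, v0)) + (1 / s) * (d \<bullet> (x, v))"
      using v d v1 face_subset[OF F(1)] s(1) by (intro add_left_mono mult_left_mono) auto
    finally have "0 \<le> (1 - 1 / s) * (d \<bullet> (x0, v0) - d \<bullet> (x, v))"
      by (simp add: algebra_simps)
    moreover have "1 - 1 / s > 0" using s(1) by simp
    ultimately have "d \<bullet> (x, v) \<le> d \<bullet> (x0, v0)" by (simp add: zero_le_mult_iff)
    then have "(x0, v0) \<in> G" using v d v0(1) by (auto intro: order_trans)
    then show ?thesis by force
  qed
  then show "chamber D x0 \<subseteq> chamber D x" by (auto simp: mem_chamber_iff)
qed

text \<open>
  An extreme point \<open>v\<close> of a chamber is extreme in its own, smaller chamber and lies in the relative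
  interior of the latter, which must therefore be a point.
\<close>

lemma extreme_point_of_chamber_is_vertex:
  assumes "x \<in> fst ` D" "v extreme_point_of chamber D x"
  shows "v \<in> chamber_vertices D"
proof -
  have "v \<in> chamber D x" using assms(2) by (simp add: extreme_point_of_def)
  then have v: "v \<in> fst ` D" "chamber D v \<subseteq> chamber D x"
    using chamber_subset[OF assms(1)] by (auto simp: mem_chamber_iff)
  then have "v extreme_point_of chamber D v"
    using assms(2) mem_chamber_self[of v D] by (auto simp: extreme_point_of_def)
  then have "chamber D v = {v}"
    using mem_rel_interior_chamber[OF v(1)] extreme_point_not_in_REL_INTERIOR by blast
  then show ?thesis
    unfolding chamber_vertices_def chamber_complex_def using v(1) by force
qed

text \<open>Wherever they are unique, minimisers over the fibers are affine functions on each chamber.\<close>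

lemma fiber_minimiser_affine_on_chamber:
  assumes "x \<in> fst ` D" "x1 \<in> chamber D x" "x2 \<in> chamber D x" "0 \<le> t" "t \<le> 1"
    and uniq: "\<And>i v. i \<in> {x1, x2, (1 - t) *\<^sub>R x1 + t *\<^sub>R x2} \<Longrightarrow> (i, v) \<in> D \<Longrightarrow>
      (\<And>w. (i, w) \<in> D \<Longrightarrow> e \<bullet> v \<le> e \<bullet> w) \<Longrightarrow> v = y i"
  shows "y ((1 - t) *\<^sub>R x1 + t *\<^sub>R x2) = (1 - t) *\<^sub>R y x1 + t *\<^sub>R y x2"
proof -
  obtain v where v: "(x, v) \<in> D" "\<And>w. (x, w) \<in> D \<Longrightarrow> e \<bullet> v \<le> e \<bullet> w"
    using obtain_fiber_minimiser[OF assms(1), of e] by metis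
  obtain F where F: "F \<in> faces D" "(x, v) \<in> rel_interior F"
      "\<And>x'. x' \<in> chamber D x \<Longrightarrow> \<exists>v'. (x', v') \<in> F"
    using obtain_face[OF v(1)] by metis
  have eq: "v' = y i" if "(i, v') \<in> F" "i \<in> {x1, x2, (1 - t) *\<^sub>R x1 + t *\<^sub>R x2}" for i v'
    using that face_subset[OF F(1)]
      fiber_minimiser_propagates[OF convex_D convex_face[OF F(1)] face_subset[OF F(1)] F(2) v(2)]
    by (intro uniq) auto
  have 1: "(x1, y x1) \<in> F" and 2: "(x2, y x2) \<in> F"
    using F(3) assms(2,3) eq by blast+
  then have "(1 - t) *\<^sub>R (x1, y x1) + t *\<^sub>R (x2, y x2) \<in> F"
    using convex_face[OF F(1)] assms(4,5) by (intro convexD) auto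
  then have "((1 - t) *\<^sub>R x1 + t *\<^sub>R x2, (1 - t) *\<^sub>R y x1 + t *\<^sub>R y x2) \<in> F" by simp
  then show ?thesis using eq by simp
qed

end

section \<open>Functions that are affine on a convex set\<close>

lemma convex_combination_preserving_sum:
  fixes f :: "'a::real_vector \<Rightarrow> real"
  assumes "convex C"
    and aff: "\<And>x y t. x \<in> C \<Longrightarrow> y \<in> C \<Longrightarrow> 0 \<le> t \<Longrightarrow> t \<le> 1 \<Longrightarrow>
      f ((1 - t) *\<^sub>R x + t *\<^sub>R y) = (1 - t) * f x + t * f y"
    and I: "finite I" "I \<noteq> {}" "\<And>i. i \<in> I \<Longrightarrow> y i \<in> C" "\<And>i. i \<in> I \<Longrightarrow> 0 \<le> u i" "sum u I = 1"
  shows "f (\<Sum>i\<in>I. u i *\<^sub>R y i) = (\<Sum>i\<in>I. u i * f (y i))"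
proof (rule antisym)
  have "convex_on C f" "convex_on C (\<lambda>x. - f x)"
    using aff \<open>convex C\<close> by (auto intro!: convex_onI simp: algebra_simps)
  from convex_on_sum[OF I(1,2) this(1) I(5)] convex_on_sum[OF I(1,2) this(2) I(5)]
  show "f (\<Sum>i\<in>I. u i *\<^sub>R y i) \<le> (\<Sum>i\<in>I. u i * f (y i))"
    "(\<Sum>i\<in>I. u i * f (y i)) \<le> f (\<Sum>i\<in>I. u i *\<^sub>R y i)"
    using I by (auto simp: sum_negf)
qed

text \<open>
  The same for affine combinations with coefficients of arbitrary sign, provided that the combined
  point stays in the set: the negative terms are moved to the side of the combined point.
\<close>

lemma affine_combination_preserving_sum:
  fixes f :: "'a::real_vector \<Rightarrow> real"
  assumes "convex C"
    and aff: "\<And>x y t. x \<in> C \<Longrightarrow> y \<in> C \<Longrightarrow> 0 \<le> t \<Longrightarrow> t \<le> 1 \<Longrightarrow>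
      f ((1 - t) *\<^sub>R x + t *\<^sub>R y) = (1 - t) * f x + t * f y"
    and I: "finite I" "\<And>i. i \<in> I \<Longrightarrow> y i \<in> C" "sum u I = 1"
    and x: "x = (\<Sum>i\<in>I. u i *\<^sub>R y i)" "x \<in> C"
  shows "f x = (\<Sum>i\<in>I. u i * f (y i))"
proof -
  define Pos where "Pos = {i \<in> I. 0 \<le> u i}"
  define Neg where "Neg = {i \<in> I. u i < 0}"
  have I_eq: "I = Pos \<union> Neg" "Pos \<inter> Neg = {}" "finite Pos" "finite Neg"
    using I by (auto simp: Pos_def Neg_def)
  have split: "sum g I = sum g Pos + sum g Neg" for g :: "_ \<Rightarrow> real"
    using sum.union_disjoint[OF I_eq(3,4,2), of g] I_eq(1) by simp
  have split_vec: "sum g I = sum g Pos + sum g Neg" for g :: "_ \<Rightarrow> 'a"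
    using sum.union_disjoint[OF I_eq(3,4,2), of g] I_eq(1) by simp
  note sum_preserved = convex_combination_preserving_sum[OF \<open>convex C\<close> aff]
  define s where "s = 1 - sum u Neg"
  have s: "s = sum u Pos" using I(3) split[of u] by (simp add: s_def)
  have "sum u Neg \<le> 0" by (auto simp: Neg_def intro!: sum_nonpos)
  then have "s \<ge> 1" by (simp add: s_def)
  then have "Pos \<noteq> {}" using s by auto
  have Pos: "f (\<Sum>i\<in>Pos. (u i / s) *\<^sub>R y i) = (\<Sum>i\<in>Pos. (u i / s) * f (y i))"
  proof (rule sum_preserved)
    show "(\<Sum>i\<in>Pos. u i / s) = 1"
      using \<open>s \<ge> 1\<close> s by (simp add: sum_divide_distrib[symmetric])
  qed (use \<open>s \<ge> 1\<close> \<open>Pos \<noteq> {}\<close> \<open>finite Pos\<close> I(2) in \<open>auto simp: Pos_def\<close>)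
  show ?thesis
  proof (cases "Neg = {}")
    case True
    then show ?thesis
      using Pos s x(1) by (simp add: split split_vec s_def)
  next
    case False
    define r where "r = - sum u Neg"
    have "r > 0"
      using sum_strict_mono[OF \<open>finite Neg\<close> False, of u "\<lambda>_. 0"] by (simp add: r_def Neg_def)
    have sr: "s = 1 + r" by (simp add: s_def r_def)
    define q where "q = (\<Sum>i\<in>Neg. (- u i / r) *\<^sub>R y i)"
    have w: "(\<Sum>i\<in>Neg. - u i / r) = 1"
      using \<open>r > 0\<close> by (simp add: sum_divide_distrib[symmetric] r_def sum_negf)
    have w_pos: "0 \<le> - u i / r" if "i \<in> Neg" for i
      using that \<open>r > 0\<close> by (intro divide_nonneg_pos) (auto simp: Neg_def)
    have f_q: "f q = (\<Sum>i\<in>Neg. (- u i / r) * f (y i))"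
      unfolding q_def using False I(2) \<open>finite Neg\<close> w w_pos I_eq(1)
      by (intro sum_preserved) blast+
    have "q \<in> C"
      unfolding q_def using I(2) \<open>finite Neg\<close> w w_pos \<open>convex C\<close> I_eq(1)
      by (intro convex_sum) blast+
    have rq: "r *\<^sub>R q = - (\<Sum>i\<in>Neg. u i *\<^sub>R y i)"
      using \<open>r > 0\<close> by (simp add: q_def scaleR_sum_right sum_negf)
    have "s *\<^sub>R ((1 - r / s) *\<^sub>R x + (r / s) *\<^sub>R q) = x + r *\<^sub>R q"
      using \<open>s \<ge> 1\<close> by (simp add: algebra_simps) (simp add: sr scaleR_left_distrib)
    also have "\<dots> = (\<Sum>i\<in>Pos. u i *\<^sub>R y i)"
      unfolding rq using x(1) split_vec[of "\<lambda>i. u i *\<^sub>R y i"] by simp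
    also have "\<dots> = s *\<^sub>R (\<Sum>i\<in>Pos. (u i / s) *\<^sub>R y i)"
      using \<open>s \<ge> 1\<close> by (simp add: scaleR_sum_right)
    finally have "(1 - r / s) *\<^sub>R x + (r / s) *\<^sub>R q = (\<Sum>i\<in>Pos. (u i / s) *\<^sub>R y i)"
      using \<open>s \<ge> 1\<close> by simp
    moreover have "f ((1 - r / s) *\<^sub>R x + (r / s) *\<^sub>R q) = (1 - r / s) * f x + (r / s) * f q"
      using x \<open>q \<in> C\<close> \<open>s \<ge> 1\<close> \<open>r > 0\<close> by (intro aff) (auto simp: sr)
    ultimately have "(1 - r / s) * f x + (r / s) * f q = (\<Sum>i\<in>Pos. u i * f (y i)) / s"
      using Pos by (simp add: sum_divide_distrib)
    then have "s * ((1 - r / s) * f x + (r / s) * f q) = (\<Sum>i\<in>Pos. u i * f (y i))"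
      using \<open>s \<ge> 1\<close> by (simp add: field_simps)
    moreover have "s * ((1 - r / s) * f x + (r / s) * f q) = f x + r * f q"
      using \<open>s \<ge> 1\<close> by (simp add: algebra_simps) (simp add: sr algebra_simps)
    moreover have "r * f q = - (\<Sum>i\<in>Neg. u i * f (y i))"
      using \<open>r > 0\<close> by (simp add: f_q sum_distrib_left sum_negf)
    ultimately show ?thesis
      using split[of "\<lambda>i. u i * f (y i)"] by simp
  qed
qed

text \<open>
  The linear part is prescribed on a basis \<open>B\<close> that consists of differences \<open>x - x0\<close> of points of the
  set; the preceding lemma, with \<open>0\<close> added to \<open>B\<close> to make the coefficients sum to one, shows that the
  resulting affine function agrees with \<open>f\<close>.
\<close>

lemma affine_on_convex_imp_inner:
  fixes f :: "'a::euclidean_space \<Rightarrow> real"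
  assumes "convex C"
    and aff: "\<And>x y t. x \<in> C \<Longrightarrow> y \<in> C \<Longrightarrow> 0 \<le> t \<Longrightarrow> t \<le> 1 \<Longrightarrow>
      f ((1 - t) *\<^sub>R x + t *\<^sub>R y) = (1 - t) * f x + t * f y"
  shows "\<exists>d a. \<forall>x\<in>C. f x = d \<bullet> x + a"
proof (cases "C = {}")
  case False
  then obtain x0 where "x0 \<in> C" by blast
  obtain B where B: "B \<subseteq> (\<lambda>x. x - x0) ` C" "independent B" "(\<lambda>x. x - x0) ` C \<subseteq> span B"
    using basis_exists[of "(\<lambda>x. x - x0) ` C"] by metis
  have "finite B" using B(2) independent_imp_finite by blast
  have "0 \<notin> B" using B(2) dependent_zero by blast
  obtain g where g: "linear g" "\<And>b. b \<in> B \<Longrightarrow> g b = f (x0 + b) - f x0"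
    using linear_independent_extend[OF B(2), of "\<lambda>b. f (x0 + b) - f x0"] by blast
  have "f x = adjoint g 1 \<bullet> x + (f x0 - adjoint g 1 \<bullet> x0)" if "x \<in> C" for x
  proof -
    have "x - x0 \<in> span B" using B(3) that by blast
    then obtain u where u: "x - x0 = (\<Sum>b\<in>B. u b *\<^sub>R b)"
      using span_finite[OF \<open>finite B\<close>] by auto
    define v where "v b = (if b = 0 then 1 - sum u B else u b)" for b
    have v_B: "v b = u b" if "b \<in> B" for b using that \<open>0 \<notin> B\<close> by (auto simp: v_def)
    have sum_v: "sum v (insert 0 B) = 1"
      using \<open>finite B\<close> \<open>0 \<notin> B\<close> v_B by (simp add: v_def)
    have "(\<Sum>b\<in>insert 0 B. v b *\<^sub>R (x0 + b)) = sum v (insert 0 B) *\<^sub>R x0 + (\<Sum>b\<in>insert 0 B. v b *\<^sub>R b)"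
      by (simp add: scaleR_right_distrib sum.distrib scaleR_sum_left)
    also have "\<dots> = x"
      using \<open>finite B\<close> \<open>0 \<notin> B\<close> v_B sum_v u by (simp add: algebra_simps)
    finally have x: "x = (\<Sum>b\<in>insert 0 B. v b *\<^sub>R (x0 + b))" by simp
    have "x0 + b \<in> C" if "b \<in> insert 0 B" for b
      using B(1) \<open>x0 \<in> C\<close> that by auto
    then have "f x = (\<Sum>b\<in>insert 0 B. v b * f (x0 + b))"
      using \<open>finite B\<close> \<open>x \<in> C\<close> sum_v x
      by (intro affine_combination_preserving_sum[OF \<open>convex C\<close> aff]) auto
    also have "\<dots> = (\<Sum>b\<in>insert 0 B. v b * f x0 + v b * (f (x0 + b) - f x0))"
      by (simp add: algebra_simps)
    also have "\<dots> = sum v (insert 0 B) * f x0 + (\<Sum>b\<in>insert 0 B. v b * (f (x0 + b) - f x0))"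
      by (simp only: sum.distrib sum_distrib_right)
    also have "(\<Sum>b\<in>insert 0 B. v b * (f (x0 + b) - f x0)) = (\<Sum>b\<in>B. u b * g b)"
      using \<open>finite B\<close> \<open>0 \<notin> B\<close> v_B g by simp
    also have "\<dots> = g (x - x0)"
      unfolding u using g(1) by (simp add: linear_sum linear_scale)
    also have "\<dots> = adjoint g 1 \<bullet> (x - x0)"
      using adjoint_works[OF g(1), of "x - x0" 1] by (simp add: inner_commute)
    finally show ?thesis
      using sum_v by (simp add: inner_diff_right)
  qed
  then show ?thesis by blast
qed simp

section \<open>Minimisation and lower semicontinuity\<close>

lemma lower_semicontinuous_on_sequence:
  assumes "lower_semicontinuous_on S f" "\<And>n. z n \<in> S" "z0 \<in> S" "z \<longlonglongrightarrow> z0" "a < f z0"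
  shows "\<forall>\<^sub>F n in sequentially. a < f (z n)"
proof -
  have "eventually (\<lambda>w. a < f w) (at z0 within S)"
    using assms(1,3,5) by (auto simp: lower_semicontinuous_on_def)
  then obtain U where U: "open U" "z0 \<in> U" "\<And>w. w \<in> U \<Longrightarrow> w \<noteq> z0 \<Longrightarrow> w \<in> S \<Longrightarrow> a < f w"
    unfolding eventually_at_topological by blast
  have "\<forall>\<^sub>F n in sequentially. z n \<in> U"
    using assms(4) U(1,2) by (rule topological_tendstoD)
  then show ?thesis
  proof eventually_elim
    case (elim n)
    then show ?case using U(3)[of "z n"] assms(2,5) by (cases "z n = z0") auto
  qed
qed

lemma lower_semicontinuous_on_compact_bounded_below:
  fixes f :: "'a::metric_space \<Rightarrow> real"
  assumes "compact S" "lower_semicontinuous_on S f"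
  shows "\<exists>m. \<forall>z\<in>S. m \<le> f z"
proof (rule ccontr)
  assume "\<nexists>m. \<forall>z\<in>S. m \<le> f z"
  then have "\<exists>z\<in>S. f z < - real n" for n by (metis linorder_not_le)
  then obtain z where z: "\<And>n. z n \<in> S" "\<And>n. f (z n) < - real n" by metis
  obtain l r where l: "l \<in> S" "strict_mono r" "(z \<circ> r) \<longlonglongrightarrow> l"
    using assms(1) z(1) unfolding compact_def by blast
  have "\<forall>\<^sub>F n in sequentially. f l - 1 < f ((z \<circ> r) n)"
    by (rule lower_semicontinuous_on_sequence[OF assms(2) _ l(1,3)]) (use z(1) in simp_all)
  moreover have "\<forall>\<^sub>F n in sequentially. 1 - f l \<le> real n"
    using filterlim_real_sequentially unfolding filterlim_at_top by blast
  ultimately have "\<forall>\<^sub>F n in sequentially. False"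
  proof eventually_elim
    case (elim n)
    have "real n \<le> real (r n)" using seq_suble[OF l(2), of n] by simp
    then show ?case using elim z(2)[of "r n"] by simp
  qed
  then show False by simp
qed

lemma compact_attains_inf_if_sequentially_lsc:
  fixes g :: "'a::metric_space \<Rightarrow> real"
  assumes "compact X" "X \<noteq> {}" and below: "\<And>x. x \<in> X \<Longrightarrow> m \<le> g x"
    and lsc: "\<And>u x l. (\<And>k. u k \<in> X) \<Longrightarrow> x \<in> X \<Longrightarrow> u \<longlonglongrightarrow> x \<Longrightarrow>
      (\<lambda>k. g (u k)) \<longlonglongrightarrow> l \<Longrightarrow> g x \<le> l"
  shows "\<exists>x\<in>X. \<forall>x'\<in>X. g x \<le> g x'"
proof -
  have bdd: "bdd_below (g ` X)" using below by (intro bdd_belowI2)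
  then have "Inf (g ` X) \<in> closure (g ` X)"
    using assms(2) by (intro closure_contains_Inf) auto
  then obtain v where v: "\<And>k. v k \<in> g ` X" "v \<longlonglongrightarrow> Inf (g ` X)"
    unfolding closure_sequential by blast
  then have "\<forall>k. \<exists>x\<in>X. v k = g x" by blast
  then obtain u where u: "\<And>k. u k \<in> X" "\<And>k. v k = g (u k)" by metis
  obtain x r where x: "x \<in> X" "strict_mono r" "(u \<circ> r) \<longlonglongrightarrow> x"
    using assms(1) u(1) unfolding compact_def by blast
  have "(\<lambda>k. g ((u \<circ> r) k)) \<longlonglongrightarrow> Inf (g ` X)"
    using LIMSEQ_subseq_LIMSEQ[OF v(2) x(2)] u(2) by (simp add: o_def)
  then have "g x \<le> Inf (g ` X)"
    using u(1) x by (intro lsc[of "u \<circ> r"]) auto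
  then show ?thesis
    using x(1) cInf_lower[OF _ bdd] by (meson image_eqI order_trans)
qed

section \<open>Selecting optimal vertices\<close>

text \<open>Ties between finitely many candidates are broken measurably by comparing them one after another.\<close>

lemma measurable_minimiser_selection:
  fixes c :: "'w \<Rightarrow> 'b::euclidean_space"
  assumes [measurable]: "c \<in> borel_measurable M" and "finite E" "E \<noteq> {}"
  shows "\<exists>s\<in>borel_measurable M. \<forall>\<omega>\<in>space M. s \<omega> \<in> E \<and> (\<forall>v\<in>E. c \<omega> \<bullet> s \<omega> \<le> c \<omega> \<bullet> v)"
  using assms(2,3)
proof (induction E rule: finite_ne_induct)
  case (singleton e)
  then show ?case by (intro bexI[of _ "\<lambda>_. e"]) auto
next
  case (insert e E)
  then obtain s where [measurable]: "s \<in> borel_measurable M"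
    and s: "\<forall>\<omega>\<in>space M. s \<omega> \<in> E \<and> (\<forall>v\<in>E. c \<omega> \<bullet> s \<omega> \<le> c \<omega> \<bullet> v)"
    by blast
  define s' where "s' \<omega> = (if c \<omega> \<bullet> e < c \<omega> \<bullet> s \<omega> then e else s \<omega>)" for \<omega>
  have "s' \<in> borel_measurable M" unfolding s'_def by measurable
  moreover have "s' \<omega> \<in> insert e E \<and> (\<forall>v\<in>insert e E. c \<omega> \<bullet> s' \<omega> \<le> c \<omega> \<bullet> v)"
    if \<omega>: "\<omega> \<in> space M" for \<omega>
  proof (intro conjI ballI)
    have s\<omega>: "s \<omega> \<in> E" "\<And>v. v \<in> E \<Longrightarrow> c \<omega> \<bullet> s \<omega> \<le> c \<omega> \<bullet> v"
      using s \<omega> by auto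
    show "s' \<omega> \<in> insert e E" using s\<omega>(1) by (simp add: s'_def)
    show "c \<omega> \<bullet> s' \<omega> \<le> c \<omega> \<bullet> v" if "v \<in> insert e E" for v
      using that s\<omega>(2)[of v] by (auto simp: s'_def)
  qed
  ultimately show ?case by blast
qed

lemma measurable_optimality_set:
  fixes c :: "'w \<Rightarrow> 'b::euclidean_space"
  assumes [measurable]: "c \<in> borel_measurable M"
  shows "{\<omega> \<in> space M. - c \<omega> \<in> normal_cone C v} \<in> sets M"
proof -
  have "normal_cone C v = (\<Inter>z\<in>C. {d. d \<bullet> (z - v) \<le> 0})"
    by (auto simp: normal_cone_def)
  also have "closed \<dots>"
    by (intro closed_INT ballI closed_Collect_le continuous_intros)
  finally have [measurable]: "normal_cone C v \<in> sets borel" by (rule borel_closed)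
  show ?thesis by measurable
qed

lemma uminus_mem_normal_cone_iff: "- d \<in> normal_cone C v \<longleftrightarrow> (\<forall>z\<in>C. d \<bullet> v \<le> d \<bullet> z)"
  by (simp add: normal_cone_def inner_diff_right)

text \<open>
  A linear function that separates the vertices of a polytope has a unique minimiser: the set of
  minimisers is a face, and a face with a single vertex is a point.
\<close>

lemma unique_minimiser_if_vertices_separated:
  fixes P :: "'b::euclidean_space set"
  assumes "compact P" "convex P"
    and sep: "\<And>u v. u extreme_point_of P \<Longrightarrow> v extreme_point_of P \<Longrightarrow> u \<noteq> v \<Longrightarrow> e \<bullet> (u - v) \<noteq> 0"
    and v: "v \<in> P" "\<And>z. z \<in> P \<Longrightarrow> e \<bullet> v \<le> e \<bullet> z"
    and w: "w \<in> P" "\<And>z. z \<in> P \<Longrightarrow> e \<bullet> w \<le> e \<bullet> z"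
  shows "v = w"
proof -
  define F where "F = P \<inter> {z. e \<bullet> z = e \<bullet> v}"
  have face: "F face_of P"
    unfolding F_def by (rule face_of_Int_supporting_hyperplane_ge[OF assms(2) v(2)])
  have "v \<in> F" "w \<in> F" using v w by (auto simp: F_def intro: antisym)
  have KM: "F = convex hull {x. x extreme_point_of F}"
    by (intro Krein_Milman_Minkowski face_of_imp_compact[OF assms(2,1) face] face_of_imp_convex[OF face])
  have "{x. x extreme_point_of F} \<noteq> {}"
  proof
    assume "{x. x extreme_point_of F} = {}"
    then have "F = {}" using KM by simp
    then show False using \<open>v \<in> F\<close> by simp
  qed
  then obtain p where p: "p extreme_point_of F" by blast
  have "q = p" if "q extreme_point_of F" for q
  proof (rule ccontr)
    assume "q \<noteq> p"
    then have "e \<bullet> (q - p) \<noteq> 0"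
      using that p face by (intro sep) (simp_all add: extreme_point_of_face)
    moreover have "q \<in> F" "p \<in> F" using that p by (auto simp: extreme_point_of_def)
    ultimately show False by (simp add: F_def inner_diff_right)
  qed
  then have "{x. x extreme_point_of F} = {p}" using p by blast
  then have "F = {p}" using KM by simp
  then show ?thesis using \<open>v \<in> F\<close> \<open>w \<in> F\<close> by simp
qed

context polytope_chambers
begin

lemma compact_projections: "compact (fst ` D)" "compact (snd ` D)"
  by (rule compact_continuous_image[OF _ compact_D], rule continuous_on_fst continuous_on_snd,
      rule continuous_on_id)+

lemma polytope_fiber: "polytope (fiber D x)"
proof -
  have "D \<inter> ({x} \<times> UNIV) \<subseteq> D" by blast
  moreover have "affine ({x} \<times> (UNIV :: 'b set))"
    by (auto simp: affine_def scaleR_left_distrib[symmetric])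
  then have "polyhedron (D \<inter> ({x} \<times> UNIV))"
    by (intro polyhedron_Int polytope_imp_polyhedron[OF polytope_D] affine_imp_polyhedron)
  ultimately have "polytope (D \<inter> ({x} \<times> UNIV))"
    using bounded_subset[OF polytope_imp_bounded[OF polytope_D]]
    by (simp add: polytope_eq_bounded_polyhedron)
  moreover have "fiber D x = snd ` (D \<inter> ({x} \<times> UNIV))" by (force simp: fiber_def)
  ultimately show ?thesis using polytope_linear_image[OF linear_snd] by metis
qed

lemma compact_fiber: "compact (fiber D x)" and convex_fiber: "convex (fiber D x)"
  and finite_fiber_vertices: "finite {v. v extreme_point_of fiber D x}"
  using polytope_fiber[of x]
  by (auto intro: polytope_imp_compact polytope_imp_convex finite_polyhedron_extreme_points
      polytope_imp_polyhedron)

lemma fiber_vertices_nonempty: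
  assumes "x \<in> fst ` D"
  shows "{v. v extreme_point_of fiber D x} \<noteq> {}"
proof -
  have "fiber D x \<noteq> {}" using assms by (auto simp: fiber_def)
  then show ?thesis using extreme_point_exists_convex[OF compact_fiber convex_fiber] by blast
qed

lemma minimises_fiber_if_minimises_vertices:
  assumes "\<And>u. u extreme_point_of fiber D x \<Longrightarrow> e \<bullet> v \<le> e \<bullet> u" "(x, w) \<in> D"
  shows "e \<bullet> v \<le> e \<bullet> w"
proof -
  have "convex hull {u. u extreme_point_of fiber D x} \<subseteq> {u. e \<bullet> v \<le> e \<bullet> u}"
    using assms(1) by (intro hull_minimal) (auto simp: convex_halfspace_ge)
  moreover have "w \<in> convex hull {u. u extreme_point_of fiber D x}"
    using Krein_Milman_Minkowski[OF compact_fiber convex_fiber] assms(2) by (auto simp: fiber_def)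
  ultimately show ?thesis by blast
qed

lemma chamber_vertex_minimiser:
  assumes "x \<in> fst ` D" and min: "\<And>x'. x' \<in> fst ` D \<Longrightarrow> g x \<le> g x'"
    and aff: "\<And>z. z \<in> chamber D x \<Longrightarrow> g z = d \<bullet> z + (a::real)"
  shows "\<exists>v\<in>chamber_vertices D. \<forall>x'\<in>fst ` D. g v \<le> g x'"
proof -
  define F where "F = chamber D x \<inter> {z. d \<bullet> z = d \<bullet> x}"
  have "d \<bullet> x \<le> d \<bullet> z" if "z \<in> chamber D x" for z
    using that min[of z] chamber_subset[OF assms(1)] aff[of z] aff[OF mem_chamber_self] by auto
  then have face: "F face_of chamber D x"
    unfolding F_def by (rule face_of_Int_supporting_hyperplane_ge[OF convex_chamber])
  have "x \<in> F" using mem_chamber_self by (simp add: F_def)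
  then obtain v where v: "v extreme_point_of F"
    using extreme_point_exists_convex[OF face_of_imp_compact[OF convex_chamber
        compact_chamber[OF assms(1)] face] face_of_imp_convex[OF face]] by blast
  then have "v \<in> F" by (simp add: extreme_point_of_def)
  then have "g v = g x" using aff[of v] aff[OF mem_chamber_self] by (simp add: F_def)
  moreover have "v \<in> chamber_vertices D"
    using extreme_point_of_chamber_is_vertex[OF assms(1)] v face extreme_point_of_face by blast
  ultimately show ?thesis using min by metis
qed

end

section \<open>The belief as the law of the follower's response\<close>

text \<open>
  A response of the follower that always picks an optimal vertex, together with a random cost that
  almost surely is not orthogonal to any given nonzero vector.
\<close>

locale vertex_response = polytope_chambers D + prob_space M
  for D :: "('a::euclidean_space \<times> 'b::euclidean_space) set" and M :: "'w measure" +
  fixes c :: "'w \<Rightarrow> 'b" and y :: "'a \<Rightarrow> 'w \<Rightarrow> 'b"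
  assumes c_measurable [measurable]: "c \<in> borel_measurable M"
    and c_generic: "w \<noteq> 0 \<Longrightarrow> AE \<omega> in M. c \<omega> \<bullet> w \<noteq> 0"
    and y_measurable: "x \<in> fst ` D \<Longrightarrow> y x \<in> borel_measurable M"
    and y_vertex: "x \<in> fst ` D \<Longrightarrow> \<omega> \<in> space M \<Longrightarrow> y x \<omega> extreme_point_of fiber D x"
    and y_optimal: "(x, w) \<in> D \<Longrightarrow> \<omega> \<in> space M \<Longrightarrow> c \<omega> \<bullet> y x \<omega> \<le> c \<omega> \<bullet> w"

lemma (in polytope_chambers) vertex_response_exists:
  assumes "prob_space M" "c \<in> borel_measurable M"
    and "\<And>w. w \<noteq> 0 \<Longrightarrow> AE \<omega> in M. c \<omega> \<bullet> w \<noteq> 0"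
  shows "\<exists>y. vertex_response D M c y"
proof -
  let ?E = "\<lambda>x. {v. v extreme_point_of fiber D x}"
  have "\<forall>x\<in>fst ` D. \<exists>s. s \<in> borel_measurable M \<and>
      (\<forall>\<omega>\<in>space M. s \<omega> \<in> ?E x \<and> (\<forall>v\<in>?E x. c \<omega> \<bullet> s \<omega> \<le> c \<omega> \<bullet> v))"
    using measurable_minimiser_selection[OF assms(2) finite_fiber_vertices fiber_vertices_nonempty]
    unfolding Bex_def by (rule ballI)
  from bchoice[OF this] obtain y where y: "\<forall>x\<in>fst ` D. y x \<in> borel_measurable M \<and>
      (\<forall>\<omega>\<in>space M. y x \<omega> \<in> ?E x \<and> (\<forall>v\<in>?E x. c \<omega> \<bullet> y x \<omega> \<le> c \<omega> \<bullet> v))"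
    by (rule exE)
  have "vertex_response D M c y"
  proof (intro vertex_response.intro vertex_response_axioms.intro)
    show "polytope_chambers D" by (rule polytope_chambers_axioms)
    show "c \<omega> \<bullet> y x \<omega> \<le> c \<omega> \<bullet> w" if xw: "(x, w) \<in> D" and \<omega>: "\<omega> \<in> space M" for x w \<omega>
    proof (rule minimises_fiber_if_minimises_vertices[OF _ xw])
      have "x \<in> fst ` D" using xw by force
      then show "c \<omega> \<bullet> y x \<omega> \<le> c \<omega> \<bullet> u" if "u extreme_point_of fiber D x" for u
        using y \<omega> that by blast
    qed
    show "y x \<in> borel_measurable M" if "x \<in> fst ` D" for x
      using y that by blast
    show "y x \<omega> extreme_point_of fiber D x" if "x \<in> fst ` D" "\<omega> \<in> space M" for x \<omega>
      using y that by blast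
  qed (rule assms; assumption)+
  then show ?thesis by (rule exI[of _ y])
qed

context vertex_response
begin

lemma y_feasible: "x \<in> fst ` D \<Longrightarrow> \<omega> \<in> space M \<Longrightarrow> (x, y x \<omega>) \<in> D"
  using y_vertex[of x \<omega>] by (simp add: extreme_point_of_def fiber_def)

lemma y_measurable_restrict:
  assumes "x \<in> fst ` D"
  shows "y x \<in> measurable M (restrict_space borel (snd ` D))"
  using y_feasible[OF assms] y_measurable[OF assms]
  by (intro measurable_restrict_space2) force+

lemma AE_unique_minimiser:
  assumes "x \<in> fst ` D"
  shows "AE \<omega> in M. \<forall>v. (x, v) \<in> D \<longrightarrow> (\<forall>w. (x, w) \<in> D \<longrightarrow> c \<omega> \<bullet> v \<le> c \<omega> \<bullet> w) \<longrightarrow> v = y x \<omega>"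
proof -
  define E where "E = {v. v extreme_point_of fiber D x}"
  have "finite E" unfolding E_def by (rule finite_fiber_vertices)
  have "AE \<omega> in M. c \<omega> \<bullet> (p - q) \<noteq> 0" if "p \<noteq> q" for p q
    using that by (intro c_generic) simp
  then have "AE \<omega> in M. \<forall>r\<in>E \<times> E. fst r \<noteq> snd r \<longrightarrow> c \<omega> \<bullet> (fst r - snd r) \<noteq> 0"
    using \<open>finite E\<close> by (intro AE_finite_allI) auto
  moreover have "AE \<omega> in M. \<omega> \<in> space M" by (rule AE_space)
  ultimately show ?thesis
  proof eventually_elim
    case (elim \<omega>)
    show ?case
    proof (intro allI impI)
      fix v assume v: "(x, v) \<in> D" "\<forall>w. (x, w) \<in> D \<longrightarrow> c \<omega> \<bullet> v \<le> c \<omega> \<bullet> w"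
      show "v = y x \<omega>"
      proof (rule unique_minimiser_if_vertices_separated[OF compact_fiber convex_fiber])
        show "c \<omega> \<bullet> (p - q) \<noteq> 0"
          if "p extreme_point_of fiber D x" "q extreme_point_of fiber D x" "p \<noteq> q" for p q
          using elim(1) that by (auto simp: E_def)
      qed (use v y_feasible[OF assms elim(2)] y_optimal elim(2) in \<open>auto simp: fiber_def\<close>)
    qed
  qed
qed

lemma optimality_prob_eq:
  assumes "x \<in> fst ` D" "v extreme_point_of fiber D x"
  shows "optimality_prob M c (fiber D) x v = prob {\<omega> \<in> space M. y x \<omega> = v}"
  unfolding optimality_prob_def
proof (rule finite_measure_eq_AE)
  have "(x, v) \<in> D" using assms(2) by (simp add: extreme_point_of_def fiber_def)
  show "AE \<omega> in M. \<omega> \<in> {\<omega> \<in> space M. - c \<omega> \<in> normal_cone (fiber D x) v} \<longleftrightarrow>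
      \<omega> \<in> {\<omega> \<in> space M. y x \<omega> = v}"
    using AE_unique_minimiser[OF assms(1)] AE_space
  proof eventually_elim
    case (elim \<omega>)
    then show ?case
      using y_optimal[of x _ \<omega>] \<open>(x, v) \<in> D\<close>
      by (auto simp: uminus_mem_normal_cone_iff fiber_def)
  qed
  have [measurable]: "y x \<in> borel_measurable M" by (rule y_measurable[OF assms(1)])
  show "{\<omega> \<in> space M. y x \<omega> = v} \<in> sets M" by measurable
qed (rule measurable_optimality_set[OF c_measurable])

lemma vertex_belief_eq_distr:
  assumes "x \<in> fst ` D"
  shows "vertex_belief M c (snd ` D) (fiber D) x = distr M (restrict_space borel (snd ` D)) (y x)"
proof (rule measure_eqI)
  show "sets (vertex_belief M c (snd ` D) (fiber D) x) =
      sets (distr M (restrict_space borel (snd ` D)) (y x))"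
    by (simp add: sets_vertex_belief)
next
  fix A assume "A \<in> sets (vertex_belief M c (snd ` D) (fiber D) x)"
  then have A: "A \<in> sets (restrict_space borel (snd ` D))" by (simp add: sets_vertex_belief)
  define E where "E = {v. v extreme_point_of fiber D x}"
  have [measurable]: "y x \<in> borel_measurable M" by (rule y_measurable[OF assms])
  have "finite E" unfolding E_def by (rule finite_fiber_vertices)
  have "(\<Sum>v\<in>E. optimality_prob M c (fiber D) x v * indicator A v) =
      (\<Sum>v\<in>E \<inter> A. prob {\<omega> \<in> space M. y x \<omega> = v})"
    using \<open>finite E\<close> optimality_prob_eq[OF assms]
    by (intro sum.mono_neutral_cong_right) (auto simp: E_def indicator_def)
  also have "\<dots> = prob (\<Union>v\<in>E \<inter> A. {\<omega> \<in> space M. y x \<omega> = v})"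
    using \<open>finite E\<close>
    by (intro finite_measure_finite_Union[symmetric]) (auto simp: disjoint_family_on_def)
  also have "(\<Union>v\<in>E \<inter> A. {\<omega> \<in> space M. y x \<omega> = v}) = y x -` A \<inter> space M"
    using y_vertex[OF assms] by (auto simp: E_def)
  finally show "emeasure (vertex_belief M c (snd ` D) (fiber D) x) A =
      emeasure (distr M (restrict_space borel (snd ` D)) (y x)) A"
    using A y_measurable_restrict[OF assms]
    by (simp add: emeasure_vertex_belief emeasure_distr emeasure_eq_measure E_def)
qed

lemma integral_vertex_belief:
  assumes "x \<in> fst ` D" "h \<in> borel_measurable (restrict_space borel (snd ` D))"
  shows "(\<integral>z. h z \<partial>vertex_belief M c (snd ` D) (fiber D) x) = (\<integral>\<omega>. (h (y x \<omega>) :: real) \<partial>M)"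
  unfolding vertex_belief_eq_distr[OF assms(1)]
  by (rule integral_distr[OF y_measurable_restrict[OF assms(1)] assms(2)])

lemma measurable_compose_y:
  assumes "x \<in> fst ` D" "h \<in> borel_measurable (restrict_space borel (snd ` D))"
  shows "(\<lambda>\<omega>. h (y x \<omega>) :: real) \<in> borel_measurable M"
  using measurable_compose[OF y_measurable_restrict[OF assms(1)] assms(2)] .

text \<open>Only finitely many values of \<open>h\<close> occur, so that no boundedness assumption is needed.\<close>

lemma integrable_compose_y:
  assumes "x \<in> fst ` D" "h \<in> borel_measurable (restrict_space borel (snd ` D))"
  shows "integrable M (\<lambda>\<omega>. h (y x \<omega>) :: real)"
proof (rule integrable_const_bound)
  let ?E = "{v. v extreme_point_of fiber D x}"
  show "AE \<omega> in M. norm (h (y x \<omega>)) \<le> (\<Sum>v\<in>?E. \<bar>h v\<bar>)"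
    using AE_space
  proof eventually_elim
    case (elim \<omega>)
    then show ?case
      using member_le_sum[of "y x \<omega>" ?E "\<lambda>v. \<bar>h v\<bar>"] y_vertex[OF assms(1)] finite_fiber_vertices
      by simp
  qed
qed (rule measurable_compose_y[OF assms])

lemma belief_over_vertex_belief:
  "belief_over (fst ` D) (snd ` D) (fiber D) (vertex_belief M c (snd ` D) (fiber D))"
  unfolding belief_over_def
proof (intro ballI conjI)
  fix x assume x: "x \<in> fst ` D"
  let ?N = "restrict_space borel (snd ` D)"
  note [measurable] = y_measurable_restrict[OF x]
  show "vertex_belief M c (snd ` D) (fiber D) x \<in> space (prob_algebra ?N)"
    unfolding vertex_belief_eq_distr[OF x] space_prob_algebra by (simp add: prob_space_distr)
  have "fiber D x \<in> sets ?N"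
    unfolding sets_restrict_space using compact_imp_closed[OF compact_fiber[of x]]
    by (intro image_eqI[of _ _ "fiber D x"]) (force simp: fiber_def intro: borel_closed)+
  moreover have "y x -` fiber D x \<inter> space M = space M"
    using y_feasible[OF x] by (auto simp: fiber_def)
  ultimately show "emeasure (vertex_belief M c (snd ` D) (fiber D) x) (fiber D x) = 1"
    unfolding vertex_belief_eq_distr[OF x] by (simp add: emeasure_distr emeasure_space_1)
qed

lemma AE_y_converges:
  assumes "\<And>k. u k \<in> fst ` D" "x \<in> fst ` D" "u \<longlonglongrightarrow> x"
  shows "AE \<omega> in M. (\<lambda>k. y (u k) \<omega>) \<longlonglongrightarrow> y x \<omega>"
  using AE_unique_minimiser[OF assms(2)] AE_space
proof eventually_elim
  case (elim \<omega>)
  show ?case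
  proof (rule fiber_minimisers_converge[OF polytope_D assms(1,3)])
    show "(u k, y (u k) \<omega>) \<in> D" for k using y_feasible assms(1) elim(2) by blast
    show "c \<omega> \<bullet> y (u k) \<omega> \<le> c \<omega> \<bullet> w" if "(u k, w) \<in> D" for k w
      using y_optimal that elim(2) by blast
  qed (use elim(1) in blast)
qed

lemma weak_continuous_vertex_belief:
  "weak_continuous (fst ` D) (snd ` D) (vertex_belief M c (snd ` D) (fiber D))"
  unfolding weak_continuous_def
proof (intro allI impI)
  fix u :: "nat \<Rightarrow> 'a" and x and h :: "'b \<Rightarrow> real"
  assume u: "\<forall>k. u k \<in> fst ` D" "x \<in> fst ` D" "u \<longlonglongrightarrow> x" and h: "continuous_on (snd ` D) h"
  have h_meas: "h \<in> borel_measurable (restrict_space borel (snd ` D))"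
    using h by (rule borel_measurable_continuous_on_restrict)
  have "bounded (h ` snd ` D)"
    by (rule compact_imp_bounded[OF compact_continuous_image[OF h compact_projections(2)]])
  then obtain B where "\<forall>r\<in>h ` snd ` D. norm r \<le> B"
    unfolding bounded_iff by (rule exE)
  then have B: "norm (h z) \<le> B" if "z \<in> snd ` D" for z
    using imageI[OF that, of h] by (rule bspec)
  have y_Y: "y x \<omega> \<in> snd ` D" if "x \<in> fst ` D" "\<omega> \<in> space M" for x \<omega>
    using y_feasible[OF that] by force
  have "(\<lambda>k. \<integral>\<omega>. h (y (u k) \<omega>) \<partial>M) \<longlonglongrightarrow> (\<integral>\<omega>. h (y x \<omega>) \<partial>M)"
  proof (rule integral_dominated_convergence[where w = "\<lambda>_. B"])
    show "AE \<omega> in M. (\<lambda>k. h (y (u k) \<omega>)) \<longlonglongrightarrow> h (y x \<omega>)"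
      using AE_y_converges[OF u(1)[rule_format] u(2,3)] AE_space
    proof eventually_elim
      case (elim \<omega>)
      show ?case
        by (rule continuous_on_tendsto_compose[OF h elim(1) y_Y[OF u(2) elim(2)]])
           (rule always_eventually, rule allI, rule y_Y[OF u(1)[rule_format] elim(2)])
    qed
    show "AE \<omega> in M. norm (h (y (u k) \<omega>)) \<le> B" for k
      using AE_space by eventually_elim (rule B[OF y_Y[OF u(1)[rule_format]]])
    show "(\<lambda>\<omega>. h (y (u k) \<omega>)) \<in> borel_measurable M" for k
      by (rule measurable_compose_y[OF u(1)[rule_format] h_meas])
    show "(\<lambda>\<omega>. h (y x \<omega>)) \<in> borel_measurable M"
      by (rule measurable_compose_y[OF u(2) h_meas])
  qed simp
  then show "(\<lambda>k. \<integral>z. h z \<partial>vertex_belief M c (snd ` D) (fiber D) (u k)) \<longlonglongrightarrow>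
      (\<integral>z. h z \<partial>vertex_belief M c (snd ` D) (fiber D) x)"
    by (simp only: integral_vertex_belief[OF u(1)[rule_format] h_meas]
        integral_vertex_belief[OF u(2) h_meas])
qed

lemma lower_semicontinuous_section_measurable:
  assumes "lower_semicontinuous_on (fst ` D \<times> snd ` D) f" "x \<in> fst ` D"
  shows "(\<lambda>z. f (x, z) :: real) \<in> borel_measurable (restrict_space borel (snd ` D))"
  unfolding borel_measurable_iff_le
proof
  fix a
  have cl: "closed (snd ` D)"
    by (rule compact_imp_closed[OF compact_projections(2)])
  have "closed {z \<in> snd ` D. f (x, z) \<le> a}"
    unfolding closed_sequential_limits
  proof (intro allI impI, elim conjE)
    fix z l assume z: "\<forall>n. z n \<in> {z \<in> snd ` D. f (x, z) \<le> a}" "z \<longlonglongrightarrow> l"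
    have "l \<in> snd ` D" by (rule closed_sequentially[OF cl _ z(2)]) (use z(1) in blast)
    moreover have "f (x, l) \<le> a"
    proof (rule ccontr)
      assume "\<not> f (x, l) \<le> a"
      then have "\<forall>\<^sub>F n in sequentially. a < f (x, z n)"
        using z assms(2) \<open>l \<in> snd ` D\<close>
        by (intro lower_semicontinuous_on_sequence[OF assms(1)]) (auto intro!: tendsto_Pair)
      then obtain n where "a < f (x, z n)"
        using eventually_happens' sequentially_bot by blast
      then show False using z(1)[rule_format, of n] by simp
    qed
    ultimately show "l \<in> {z \<in> snd ` D. f (x, z) \<le> a}" by simp
  qed
  then have "{z \<in> snd ` D. f (x, z) \<le> a} \<in> sets borel" by (rule borel_closed)
  then show "{z \<in> space (restrict_space borel (snd ` D)). f (x, z) \<le> a}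
      \<in> sets (restrict_space borel (snd ` D))"
    by (auto simp: space_restrict_space sets_restrict_space
        intro!: image_eqI[of _ _ "{z \<in> snd ` D. f (x, z) \<le> a}"])
qed

lemma expected_cost_attains_inf:
  fixes f :: "'a \<times> 'b \<Rightarrow> real"
  assumes f: "lower_semicontinuous_on (fst ` D \<times> snd ` D) f"
  shows "\<exists>x\<in>fst ` D. \<forall>x'\<in>fst ` D.
    (\<integral>z. f (x, z) \<partial>vertex_belief M c (snd ` D) (fiber D) x) \<le>
    (\<integral>z. f (x', z) \<partial>vertex_belief M c (snd ` D) (fiber D) x')"
proof -
  obtain m where m: "\<And>x z. x \<in> fst ` D \<Longrightarrow> z \<in> snd ` D \<Longrightarrow> m \<le> f (x, z)"
    using lower_semicontinuous_on_compact_bounded_below[OF compact_Times[OF compact_projections] f] by auto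
  define g where "g x = (\<integral>\<omega>. f (x, y x \<omega>) \<partial>M)" for x
  have y_Y: "y x \<omega> \<in> snd ` D" if "x \<in> fst ` D" "\<omega> \<in> space M" for x \<omega>
    using y_feasible[OF that] by force
  have int: "integrable M (\<lambda>\<omega>. f (x, y x \<omega>))" if "x \<in> fst ` D" for x
    using integrable_compose_y[OF that lower_semicontinuous_section_measurable[OF f that]] .
  have m_le: "AE \<omega> in M. m \<le> f (x, y x \<omega>)" if "x \<in> fst ` D" for x
    using AE_space by eventually_elim (use m y_Y that in blast)
  have nn: "(\<integral>\<^sup>+\<omega>. ennreal (f (x, y x \<omega>) - m) \<partial>M) = ennreal (g x - m)" if "x \<in> fst ` D" for x
  proof -
    have "(\<integral>\<^sup>+\<omega>. ennreal (f (x, y x \<omega>) - m) \<partial>M) = ennreal (\<integral>\<omega>. f (x, y x \<omega>) - m \<partial>M)"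
      using int[OF that] m_le[OF that] by (intro nn_integral_eq_integral) auto
    then show ?thesis using int[OF that] by (simp add: g_def prob_space)
  qed
  have g_below: "m \<le> g x" if "x \<in> fst ` D" for x
    unfolding g_def using int[OF that] m_le[OF that] by (rule integral_ge_const)
  have "\<exists>x\<in>fst ` D. \<forall>x'\<in>fst ` D. g x \<le> g x'"
  proof (rule compact_attains_inf_if_sequentially_lsc[OF compact_projections(1)])
    show "fst ` D \<noteq> {}" using D_nonempty by simp
    fix u x l assume u: "\<And>k. u k \<in> fst ` D" "x \<in> fst ` D" "u \<longlonglongrightarrow> x" "(\<lambda>k. g (u k)) \<longlonglongrightarrow> l"
    have [measurable]: "(\<lambda>\<omega>. f (u k, y (u k) \<omega>)) \<in> borel_measurable M" for k
      using int[OF u(1)] by (rule borel_measurable_integrable)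
    \<comment> \<open>Fatou's lemma, after shifting the cost by its lower bound.\<close>
    have "AE \<omega> in M. ennreal (f (x, y x \<omega>) - m) \<le> liminf (\<lambda>k. ennreal (f (u k, y (u k) \<omega>) - m))"
      using AE_y_converges[OF u(1-3)] AE_space
    proof eventually_elim
      case (elim \<omega>)
      show ?case
        unfolding le_Liminf_iff
      proof (intro allI impI)
        fix e assume e: "e < ennreal (f (x, y x \<omega>) - m)"
        then obtain r where r: "e = ennreal r" "0 \<le> r" by (cases e) auto
        then have "m + r < f (x, y x \<omega>)" using e by (simp add: ennreal_less_iff)
        then have "\<forall>\<^sub>F k in sequentially. m + r < f (u k, y (u k) \<omega>)"
          using u elim y_Y
          by (intro lower_semicontinuous_on_sequence[OF f]) (auto intro!: tendsto_Pair)
        then show "\<forall>\<^sub>F k in sequentially. e < ennreal (f (u k, y (u k) \<omega>) - m)"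
          by eventually_elim (use r in \<open>simp add: ennreal_less_iff\<close>)
      qed
    qed
    then have "ennreal (g x - m) \<le> (\<integral>\<^sup>+\<omega>. liminf (\<lambda>k. ennreal (f (u k, y (u k) \<omega>) - m)) \<partial>M)"
      unfolding nn[OF u(2), symmetric] by (rule nn_integral_mono_AE)
    also have "(\<integral>\<^sup>+\<omega>. liminf (\<lambda>k. ennreal (f (u k, y (u k) \<omega>) - m)) \<partial>M) \<le>
        liminf (\<lambda>k. \<integral>\<^sup>+\<omega>. ennreal (f (u k, y (u k) \<omega>) - m) \<partial>M)"
      by (intro nn_integral_liminf) measurable
    also have "\<dots> = liminf (\<lambda>k. ennreal (g (u k) - m))"
      by (simp add: nn[OF u(1)])
    also have "\<dots> = ennreal (l - m)"
      using u(4) by (intro lim_imp_Liminf tendsto_ennrealI tendsto_diff tendsto_const) simp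
    finally have "ennreal (g x - m) \<le> ennreal (l - m)" .
    moreover have "m \<le> l"
      using u(4) by (rule LIMSEQ_le_const) (use g_below u(1) in blast)
    ultimately show "g x \<le> l" by (simp add: ennreal_le_iff)
  qed (use g_below in blast)
  then obtain x where x: "x \<in> fst ` D" "\<And>x'. x' \<in> fst ` D \<Longrightarrow> g x \<le> g x'" by (rule bexE) auto
  have "(\<integral>z. f (x, z) \<partial>vertex_belief M c (snd ` D) (fiber D) x) = g x" if "x \<in> fst ` D" for x
    unfolding g_def
    by (rule integral_vertex_belief[OF that lower_semicontinuous_section_measurable[OF f that]])
  then show ?thesis
    using x by (intro bexI[of _ x] ballI) simp_all
qed

end

section \<open>The Bayesian objective\<close>

context polytope_chambers
begin

text \<open>
  Since the relative interiors of the chambers partition the projection of \<open>D\<close>, only the summand of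
  the chamber of \<open>x\<close> contributes at \<open>x\<close>.
\<close>

lemma piecewise_linear_over_chambers:
  assumes "\<And>x. x \<in> fst ` D \<Longrightarrow> \<exists>d a. \<forall>z\<in>chamber D x. g z = d \<bullet> z + a"
  shows "piecewise_linear_over (chamber_complex D) (fst ` D) g"
proof -
  have "\<forall>C\<in>chamber_complex D. \<exists>p. \<forall>z\<in>C. g z = fst p \<bullet> z + snd p"
    unfolding chamber_complex_def using assms by fastforce
  from bchoice[OF this] obtain p where
    p: "\<forall>C\<in>chamber_complex D. \<forall>z\<in>C. g z = fst (p C) \<bullet> z + snd (p C)"
    by (rule exE)
  have "g x = (\<Sum>C\<in>chamber_complex D. (fst (p C) \<bullet> x + snd (p C)) * indicator (rel_interior C) x)"
    if x: "x \<in> fst ` D" for x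
  proof -
    have mem: "chamber D x \<in> chamber_complex D" unfolding chamber_complex_def using x by (rule imageI)
    have "(\<Sum>C\<in>chamber_complex D. (fst (p C) \<bullet> x + snd (p C)) * indicator (rel_interior C) x) =
        (\<Sum>C\<in>{chamber D x}. (fst (p C) \<bullet> x + snd (p C)) * indicator (rel_interior C) x)"
    proof (rule sum.mono_neutral_right[OF finite_chamber_complex])
      show "{chamber D x} \<subseteq> chamber_complex D" using mem by simp
      show "\<forall>C\<in>chamber_complex D - {chamber D x}.
          (fst (p C) \<bullet> x + snd (p C)) * indicator (rel_interior C) x = 0"
      proof
        fix C assume C: "C \<in> chamber_complex D - {chamber D x}"
        then obtain x0 where "C = chamber D x0" "x0 \<in> fst ` D"
          unfolding chamber_complex_def by blast
        then have "x \<notin> rel_interior C"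
          using C chamber_eq_if_mem_rel_interior by blast
        then show "(fst (p C) \<bullet> x + snd (p C)) * indicator (rel_interior C) x = 0" by simp
      qed
    qed
    also have "\<dots> = fst (p (chamber D x)) \<bullet> x + snd (p (chamber D x))"
      using mem_rel_interior_chamber[OF x] by simp
    also have "\<dots> = g x" using p mem mem_chamber_self[of x D] by auto
    finally show ?thesis by simp
  qed
  then show ?thesis
    unfolding piecewise_linear_over_def using finite_chamber_complex
    by (intro conjI exI[of _ "\<lambda>C. fst (p C)"] exI[of _ "\<lambda>C. snd (p C)"] ballI)
qed

end

lemma inner_measurable_restrict:
  "(\<lambda>z. d \<bullet> z) \<in> borel_measurable (restrict_space borel (S :: 'a::euclidean_space set))"
  by (intro borel_measurable_continuous_on_restrict continuous_intros)

context vertex_response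
begin

lemma integrable_inner_y: "x \<in> fst ` D \<Longrightarrow> integrable M (\<lambda>\<omega>. d \<bullet> y x \<omega>)"
  by (rule integrable_compose_y[OF _ inner_measurable_restrict])

lemma expected_response_affine_on_chamber:
  assumes "x \<in> fst ` D" "x1 \<in> chamber D x" "x2 \<in> chamber D x" "0 \<le> t" "t \<le> 1"
  shows "(\<integral>\<omega>. d \<bullet> y ((1 - t) *\<^sub>R x1 + t *\<^sub>R x2) \<omega> \<partial>M) =
    (1 - t) * (\<integral>\<omega>. d \<bullet> y x1 \<omega> \<partial>M) + t * (\<integral>\<omega>. d \<bullet> y x2 \<omega> \<partial>M)"
proof -
  define x3 where "x3 = (1 - t) *\<^sub>R x1 + t *\<^sub>R x2"
  have "x3 \<in> chamber D x"
    unfolding x3_def using convex_chamber assms by (intro convexD) auto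
  then have X: "x1 \<in> fst ` D" "x2 \<in> fst ` D" "x3 \<in> fst ` D"
    using chamber_subset[OF assms(1)] assms by blast+
  have "AE \<omega> in M. d \<bullet> y x3 \<omega> = (1 - t) * (d \<bullet> y x1 \<omega>) + t * (d \<bullet> y x2 \<omega>)"
    using AE_unique_minimiser[OF X(1)] AE_unique_minimiser[OF X(2)] AE_unique_minimiser[OF X(3)]
  proof eventually_elim
    case (elim \<omega>)
    have "y x3 \<omega> = (1 - t) *\<^sub>R y x1 \<omega> + t *\<^sub>R y x2 \<omega>"
      unfolding x3_def
    proof (rule fiber_minimiser_affine_on_chamber[OF assms, where y = "\<lambda>x. y x \<omega>" and e = "c \<omega>"])
      fix i v
      assume "i \<in> {x1, x2, (1 - t) *\<^sub>R x1 + t *\<^sub>R x2}" "(i, v) \<in> D"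
        "\<And>w. (i, w) \<in> D \<Longrightarrow> c \<omega> \<bullet> v \<le> c \<omega> \<bullet> w"
      then show "v = y i \<omega>" using elim unfolding x3_def by blast
    qed
    then show ?case by (simp add: inner_add_right)
  qed
  then have "(\<integral>\<omega>. d \<bullet> y x3 \<omega> \<partial>M) = (\<integral>\<omega>. (1 - t) * (d \<bullet> y x1 \<omega>) + t * (d \<bullet> y x2 \<omega>) \<partial>M)"
    using borel_measurable_integrable[OF integrable_inner_y] X
    by (intro integral_cong_AE borel_measurable_add borel_measurable_times borel_measurable_const)
  then show ?thesis
    using X integrable_inner_y by (simp add: x3_def)
qed

lemma bayes_objective_affine_on_chamber:
  assumes "x \<in> fst ` D"
  shows "\<exists>d a. \<forall>z\<in>chamber D x.
    d1 \<bullet> z + (\<integral>v. d2 \<bullet> v \<partial>vertex_belief M c (snd ` D) (fiber D) z) = d \<bullet> z + a"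
proof (rule affine_on_convex_imp_inner[OF convex_chamber])
  fix x1 x2 and t :: real
  assume t: "x1 \<in> chamber D x" "x2 \<in> chamber D x" "0 \<le> t" "t \<le> 1"
  let ?x3 = "(1 - t) *\<^sub>R x1 + t *\<^sub>R x2"
  have "?x3 \<in> chamber D x" using convex_chamber t by (intro convexD) auto
  then have X: "x1 \<in> fst ` D" "x2 \<in> fst ` D" "?x3 \<in> fst ` D"
    using chamber_subset[OF assms] t by blast+
  show "d1 \<bullet> ?x3 + (\<integral>v. d2 \<bullet> v \<partial>vertex_belief M c (snd ` D) (fiber D) ?x3) =
      (1 - t) * (d1 \<bullet> x1 + (\<integral>v. d2 \<bullet> v \<partial>vertex_belief M c (snd ` D) (fiber D) x1)) +
      t * (d1 \<bullet> x2 + (\<integral>v. d2 \<bullet> v \<partial>vertex_belief M c (snd ` D) (fiber D) x2))"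
    unfolding X[THEN integral_vertex_belief[OF _ inner_measurable_restrict]]
      expected_response_affine_on_chamber[OF assms t]
    by (simp add: inner_add_right algebra_simps)
qed

lemma continuous_on_bayes_objective:
  "continuous_on (fst ` D)
    (\<lambda>x. d1 \<bullet> x + (\<integral>v. d2 \<bullet> v \<partial>vertex_belief M c (snd ` D) (fiber D) x))"
proof (intro continuous_on_add continuous_on_inner continuous_on_const continuous_on_id)
  show "continuous_on (fst ` D) (\<lambda>x. \<integral>v. d2 \<bullet> v \<partial>vertex_belief M c (snd ` D) (fiber D) x)"
    unfolding continuous_on_sequentially
  proof (intro allI ballI impI, elim conjE)
    fix u x assume u: "x \<in> fst ` D" "\<forall>n. u n \<in> fst ` D" "u \<longlonglongrightarrow> x"
    have "continuous_on (snd ` D) (\<lambda>v. d2 \<bullet> v)" by (intro continuous_intros)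
    then show "((\<lambda>x. \<integral>v. d2 \<bullet> v \<partial>vertex_belief M c (snd ` D) (fiber D) x) \<circ> u) \<longlonglongrightarrow>
        (\<integral>v. d2 \<bullet> v \<partial>vertex_belief M c (snd ` D) (fiber D) x)"
      using weak_continuous_vertex_belief u unfolding weak_continuous_def o_def by blast
  qed
qed

lemma bayes_objective_minimiser_at_chamber_vertex:
  "\<exists>v\<in>chamber_vertices D. \<forall>x\<in>fst ` D.
    d1 \<bullet> v + (\<integral>w. d2 \<bullet> w \<partial>vertex_belief M c (snd ` D) (fiber D) v) \<le>
    d1 \<bullet> x + (\<integral>w. d2 \<bullet> w \<partial>vertex_belief M c (snd ` D) (fiber D) x)"
proof -
  let ?g = "\<lambda>x. d1 \<bullet> x + (\<integral>w. d2 \<bullet> w \<partial>vertex_belief M c (snd ` D) (fiber D) x)"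
  have "fst ` D \<noteq> {}" using D_nonempty by simp
  from continuous_attains_inf[OF compact_projections(1) this continuous_on_bayes_objective]
  obtain x where x: "x \<in> fst ` D" "\<forall>x'\<in>fst ` D. ?g x \<le> ?g x'" by (rule bexE)
  obtain d a where aff: "\<forall>z\<in>chamber D x. ?g z = d \<bullet> z + a"
    using bayes_objective_affine_on_chamber[OF x(1), of d1 d2] by blast
  show ?thesis
    by (rule chamber_vertex_minimiser[OF x(1) bspec[OF x(2)] bspec[OF aff]])
qed

end

section \<open>The bilevel problem\<close>

lemma polyhedron_constraint_set: "polyhedron (constraint_set Al Af Bf bl bf)"
proof -
  have "constraint_set Al Af Bf bl bf =
      (\<Inter>i. {p. (Al $ i, 0) \<bullet> p \<le> bl $ i}) \<inter> (\<Inter>i. {p. (Af $ i, Bf $ i) \<bullet> p \<le> bf $ i})"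
    by (auto simp: constraint_set_def less_eq_vec_def matrix_vector_mul_component)
  also have "polyhedron \<dots>"
    by (intro polyhedron_Int polyhedron_Inter) (auto intro: polyhedron_halfspace_le)
  finally show ?thesis .
qed

lemma is_arg_min_follower_iff:
  assumes "Al *v x \<le> bl"
  shows "is_arg_min (\<lambda>u. e \<bullet> u) (\<lambda>u. Af *v x + Bf *v u \<le> bf) v \<longleftrightarrow>
    (x, v) \<in> constraint_set Al Af Bf bl bf \<and>
    (\<forall>w. (x, w) \<in> constraint_set Al Af Bf bl bf \<longrightarrow> e \<bullet> v \<le> e \<bullet> w)"
  using assms by (auto simp: is_arg_min_def constraint_set_def not_less)

theorem theorem3p6:
  fixes Al :: "real^'n^'l" and Af :: "real^'n^'f" and Bf :: "real^'p^'f"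
    and bl :: "real^'l" and bf :: "real^'f"
    and D :: "((real^'n) \<times> (real^'p)) set" and X :: "(real^'n) set" and Y :: "(real^'p) set"
    and M :: "'w measure" and c :: "'w \<Rightarrow> real^'p"
    and \<beta> :: "real^'n \<Rightarrow> (real^'p) measure"
    and d1 :: "real^'n" and d2 :: "real^'p" and \<theta> :: "real^'n \<Rightarrow> real"
  assumes D_def: "D = constraint_set Al Af Bf bl bf"
    and compact_D: "compact D"
    and full_dim_D: "aff_dim D = int DIM((real^'n) \<times> (real^'p))"
    and X_def: "X = fst ` D" and Y_def: "Y = snd ` D"
    and prob: "prob_space M"
    and cost: "nonatomic_cost M c"
    and \<beta>_def: "\<beta> = vertex_belief M c Y (fiber D)"
    and \<theta>_def: "\<theta> = (\<lambda>x. inner d1 x + (\<integral>y. inner d2 y \<partial>(\<beta> x)))"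
  shows
    "(belief_over X Y (fiber D) \<beta> \<and> weak_continuous X Y \<beta> \<and>
      (\<forall>f :: (real^'n) \<times> (real^'p) \<Rightarrow> real. lower_semicontinuous_on (X \<times> Y) f \<longrightarrow>
         (\<exists>x. is_arg_min (\<lambda>x. \<integral>y. f (x, y) \<partial>(\<beta> x)) (\<lambda>x. x \<in> X) x))) \<and>
     (continuous_on X \<theta> \<and> piecewise_linear_over (chamber_complex D) X \<theta>) \<and>
     ((\<forall>x. x \<in> X \<longleftrightarrow> (\<exists>y. bilevel_feasible M c Al Af Bf bl bf (x, y))) \<and>
      (\<forall>x y. bilevel_feasible M c Al Af Bf bl bf (x, y) \<longrightarrow> bilevel_objective M d1 d2 (x, y) = \<theta> x) \<and>
      (\<exists>v \<in> chamber_vertices D.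
         is_arg_min \<theta> (\<lambda>x. x \<in> X) v \<and>
         (\<exists>y. is_arg_min (bilevel_objective M d1 d2) (bilevel_feasible M c Al Af Bf bl bf) (v, y))))"
proof -
  have "polytope D"
    using polyhedron_constraint_set compact_imp_bounded[OF compact_D]
    by (simp add: polytope_eq_bounded_polyhedron D_def)
  moreover have "D \<noteq> {}" using full_dim_D by auto
  ultimately interpret polytope_chambers D by unfold_locales
  have c_meas: "c \<in> borel_measurable M" using cost by (simp add: nonatomic_cost_def)
  obtain y where "vertex_response D M c y"
    using vertex_response_exists[OF prob c_meas nonatomic_cost_AE_inner_nonzero[OF prob cost]] by blast
  then interpret vertex_response D M c y .
  note \<beta> = \<beta>_def[unfolded Y_def] and \<theta> = \<theta>_def[unfolded \<beta>_def Y_def]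
  have feasibleI: "bilevel_feasible M c Al Af Bf bl bf (x, y x)" if x: "x \<in> X" for x
  proof -
    have "Al *v x \<le> bl" using x by (auto simp: X_def D_def constraint_set_def)
    moreover have "AE \<omega> in M. is_arg_min (\<lambda>u. c \<omega> \<bullet> u) (\<lambda>u. Af *v x + Bf *v u \<le> bf) (y x \<omega>)"
      using AE_space
    proof eventually_elim
      case (elim \<omega>)
      then show ?case
        unfolding is_arg_min_follower_iff[OF \<open>Al *v x \<le> bl\<close>] D_def[symmetric]
        using y_feasible[OF x[unfolded X_def]] y_optimal by blast
    qed
    ultimately show ?thesis
      using y_measurable[OF x[unfolded X_def]] by (simp add: bilevel_feasible_def)
  qed
  have feasibleD: "x \<in> X \<and> (AE \<omega> in M. z \<omega> = y x \<omega>) \<and> z \<in> borel_measurable M"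
    if "bilevel_feasible M c Al Af Bf bl bf (x, z)" for x z
  proof -
    have Al: "Al *v x \<le> bl" and z: "z \<in> borel_measurable M"
      and "AE \<omega> in M. is_arg_min (\<lambda>u. c \<omega> \<bullet> u) (\<lambda>u. Af *v x + Bf *v u \<le> bf) (z \<omega>)"
      using that by (auto simp: bilevel_feasible_def)
    then have AE: "AE \<omega> in M. (x, z \<omega>) \<in> D \<and> (\<forall>w. (x, w) \<in> D \<longrightarrow> c \<omega> \<bullet> z \<omega> \<le> c \<omega> \<bullet> w)"
      unfolding is_arg_min_follower_iff[OF Al] D_def[symmetric] by blast
    have "x \<in> X"
    proof (rule ccontr)
      assume "x \<notin> X"
      then have "(x, w) \<notin> D" for w unfolding X_def by force
      then have "AE \<omega> in M. False" using AE by simp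
      then show False by simp
    qed
    moreover have "AE \<omega> in M. z \<omega> = y x \<omega>"
      using AE AE_unique_minimiser[OF \<open>x \<in> X\<close>[unfolded X_def]] by eventually_elim blast
    ultimately show ?thesis using z by blast
  qed
  have objective: "bilevel_objective M d1 d2 (x, z) = \<theta> x"
    if "bilevel_feasible M c Al Af Bf bl bf (x, z)" for x z
  proof -
    have x: "x \<in> fst ` D" and AE: "AE \<omega> in M. z \<omega> = y x \<omega>" and z: "z \<in> borel_measurable M"
      using feasibleD[OF that] unfolding X_def by blast+
    have "(\<integral>\<omega>. d2 \<bullet> z \<omega> \<partial>M) = (\<integral>\<omega>. d2 \<bullet> y x \<omega> \<partial>M)"
    proof (rule integral_cong_AE)
      show "AE \<omega> in M. d2 \<bullet> z \<omega> = d2 \<bullet> y x \<omega>" using AE by eventually_elim simp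
    qed (use z y_measurable[OF x] in measurable)
    then show ?thesis
      by (simp add: bilevel_objective_def \<theta> integral_vertex_belief[OF x inner_measurable_restrict])
  qed
  obtain v where v: "v \<in> chamber_vertices D" "\<And>x. x \<in> X \<Longrightarrow> \<theta> v \<le> \<theta> x"
    using bayes_objective_minimiser_at_chamber_vertex[of d1 d2] unfolding \<theta> X_def by blast
  have "v \<in> X" using v(1) by (simp add: chamber_vertices_def X_def)
  have "is_arg_min \<theta> (\<lambda>x. x \<in> X) v"
    using v(2) \<open>v \<in> X\<close> by (auto simp: is_arg_min_def not_less)
  moreover have "is_arg_min (bilevel_objective M d1 d2) (bilevel_feasible M c Al Af Bf bl bf) (v, y v)"
    unfolding is_arg_min_def
  proof (intro conjI notI)
    show "bilevel_feasible M c Al Af Bf bl bf (v, y v)" by (rule feasibleI[OF \<open>v \<in> X\<close>])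
    assume "\<exists>q. bilevel_feasible M c Al Af Bf bl bf q \<and>
        bilevel_objective M d1 d2 q < bilevel_objective M d1 d2 (v, y v)"
    then obtain x z where "bilevel_feasible M c Al Af Bf bl bf (x, z)"
      "bilevel_objective M d1 d2 (x, z) < bilevel_objective M d1 d2 (v, y v)" by auto
    then have "x \<in> X" "\<theta> x < \<theta> v"
      using feasibleD objective objective[OF feasibleI[OF \<open>v \<in> X\<close>]] by auto
    then show False using v(2)[of x] by simp
  qed
  ultimately have vertex: "\<exists>v \<in> chamber_vertices D. is_arg_min \<theta> (\<lambda>x. x \<in> X) v \<and>
      (\<exists>y. is_arg_min (bilevel_objective M d1 d2) (bilevel_feasible M c Al Af Bf bl bf) (v, y))"
    using v(1) by blast
  have "\<exists>x. is_arg_min (\<lambda>x. \<integral>y. f (x, y) \<partial>(\<beta> x)) (\<lambda>x. x \<in> X) x"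
    if "lower_semicontinuous_on (X \<times> Y) f" for f :: "(real^'n) \<times> (real^'p) \<Rightarrow> real"
    using expected_cost_attains_inf[OF that[unfolded X_def Y_def]]
    unfolding \<beta> X_def is_arg_min_def not_ex de_Morgan_conj not_less by blast
  moreover have "belief_over X Y (fiber D) \<beta>" "weak_continuous X Y \<beta>"
    unfolding X_def Y_def \<beta> by (rule belief_over_vertex_belief, rule weak_continuous_vertex_belief)
  moreover have "continuous_on X \<theta>"
    unfolding X_def \<theta> by (rule continuous_on_bayes_objective)
  moreover have "piecewise_linear_over (chamber_complex D) X \<theta>"
    unfolding X_def \<theta> by (rule piecewise_linear_over_chambers[OF bayes_objective_affine_on_chamber])
  moreover have "\<forall>x. x \<in> X \<longleftrightarrow> (\<exists>y. bilevel_feasible M c Al Af Bf bl bf (x, y))"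
    using feasibleI feasibleD by blast
  ultimately show ?thesis using objective vertex by blast
qed

end
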